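(* For all $\rho,\beta>0$ the radius of convexity $r^{c}(h_{\rho,\beta})$ of the function $h_{\rho,\beta}$ is the smallest positive root of the equation $(zh'_{\rho,\beta}(z))'=0$ and satisfies the inequalities $$\frac{\Gamma(\rho+\beta)}{4\Gamma(\beta)}<r^{c}(h_{\rho,\beta})<\frac{4\Gamma(\rho+\beta)\Gamma(2\rho+\beta)}{\Delta_{16,9}(\rho,\beta)}$$ and $$\sqrt{\frac{\Gamma^{2}(\rho+\beta)\Gamma(2\rho+\beta)}{\Gamma(\beta)\Delta_{16,9}(\rho,\beta)}}<r^{c}(h_{\rho,\beta})<\frac{\Gamma(\rho+\beta)\Gamma(3\rho+\beta)\Delta_{16,9}(\rho,\beta)}{8\Gamma^{3}(\rho+\beta)\Gamma(2\rho+\beta)+2\Gamma(\beta)\Gamma(3\rho+\beta)\Delta_{32,27}(\rho,\beta)}.$$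
   Context: The Wright function is the entire function (of $z$) $\phi(\rho,\beta,z)=\sum_{n\ge 0}\frac{z^n}{n!\,\Gamma(n\rho+\beta)}$, and $h_{\rho,\beta}(z)=z\,\Gamma(\beta)\phi(\rho,\beta,-z)$. Notation: $\Delta_{a,b}(\rho,\beta)=a\,\Gamma(\beta)\Gamma(2\rho+\beta)-b\,\Gamma^2(\rho+\beta)$, and $\Gamma^k(x)=(\Gamma(x))^k$. For $r>0$ let $\mathbb{D}_r=\{z\in\mathbb{C}:|z|<r\}$. For an analytic $f$ normalized by $f(0)=f'(0)-1=0$, the radius of convexity (of order $0$) is $r^{c}(f)=\sup\{r>0:\ \operatorname{Re}(1+zf''(z)/f'(z))>0\ \text{for all } z\in\mathbb{D}_r\}$. *)

theory Defs
  imports "HOL-Complex_Analysis.Complex_Analysis" "HOL-Library.Extended_Real"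
begin

definition wright_phi :: "real \<Rightarrow> real \<Rightarrow> complex \<Rightarrow> complex" where
  "wright_phi \<rho> \<beta> z =
     (\<Sum>n. z ^ n / (fact n * of_real (Gamma (of_nat n * \<rho> + \<beta>))))"

definition wright_h :: "real \<Rightarrow> real \<Rightarrow> complex \<Rightarrow> complex" where
  "wright_h \<rho> \<beta> z = z * of_real (Gamma \<beta>) * wright_phi \<rho> \<beta> (- z)"

definition wright_Delta :: "real \<Rightarrow> real \<Rightarrow> real \<Rightarrow> real \<Rightarrow> real" where
  "wright_Delta a b \<rho> \<beta> =
     a * Gamma \<beta> * Gamma (2 * \<rho> + \<beta>) - b * (Gamma (\<rho> + \<beta>))\<^sup>2"

(* Holomorphy on the disc and non-vanishing of the derivative say that the quotient is defined
   there; they are explicit because deriv and division are total.  The supremum is taken in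
   ereal, so that it is infinite, not unspecified, if no finite bound exists. *)
definition radius_of_convexity :: "(complex \<Rightarrow> complex) \<Rightarrow> ereal" where
  "radius_of_convexity f =
     Sup (ereal ` {r. r > 0 \<and> f holomorphic_on ball 0 r \<and>
       (\<forall>z\<in>ball 0 r. deriv f z \<noteq> 0 \<and> Re (1 + z * deriv (deriv f) z / deriv f z) > 0)})"

definition smallest_positive_root :: "(complex \<Rightarrow> complex) \<Rightarrow> real \<Rightarrow> bool" where
  "smallest_positive_root F x \<longleftrightarrow>
     x > 0 \<and> F (of_real x) = 0 \<and> (\<forall>y::real. y > 0 \<and> F (of_real y) = 0 \<longrightarrow> x \<le> y)"

end

theory Submission
  imports Defs "HOL-Computational_Algebra.Fundamental_Theorem_Algebra" "HOL-Real_Asymp.Real_Asymp"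
begin

text \<open>By Euler's product for \<open>1 / \<Gamma>\<close>, both \<open>f = h'\<close> and \<open>g = (z h')'\<close> are locally uniform limits of
  polynomials obtained from \<open>(1 - c z) ^ n\<close> by operators \<open>p \<mapsto> p + a z p'\<close> with \<open>a > 0\<close>, which preserve
  the property of having only positive roots. For such polynomials the power sums of the inverse
  roots are bounded by powers of the largest inverse root, and Newton's identities express them
  through the coefficients; in the limit this gives the Euler-Rayleigh inequalities for the smallest
  root of \<open>g\<close>. Equality is impossible, because the coefficients would then satisfy a
  three-term recurrence that contradicts the decay of \<open>1 / \<Gamma>(n \<rho> + \<beta>)\<close>. Writing
  \<open>1 + z h'' / h' = g / f = 1 - \<Sum> x z / (1 - x z)\<close> in the limit shows that its real part on a circle is
  least on the positive axis, so convexity fails exactly at the smallest root of \<open>g\<close>.\<close>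

subsection \<open>Polynomials with positive roots\<close>

text \<open>The entries are the inverse roots with multiplicity. The constant term is thus 1, and in
  a limit of growing degree roots may escape to infinity as entries tending to 0.\<close>

definition root_poly :: "real list \<Rightarrow> complex poly" where
  "root_poly xs = (\<Prod>x\<leftarrow>xs. [:1, - of_real x:])"

lemma root_poly_simps [simp]:
  "root_poly [] = 1" "root_poly (x # xs) = [:1, - of_real x:] * root_poly xs"
  by (simp_all add: root_poly_def)

lemma poly_root_poly_0 [simp]: "poly (root_poly xs) 0 = 1"
  by (induction xs) simp_all

lemma poly_root_poly_eq_0_iff:
  "poly (root_poly xs) z = 0 \<longleftrightarrow> (\<exists>x\<in>set xs. of_real x * z = 1)"
  by (induction xs) (auto simp: algebra_simps)

lemma root_poly_exists:
  assumes "poly p 0 = 1" "\<And>z. poly p z = 0 \<Longrightarrow> z \<in> \<real> \<and> Re z > 0"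
  shows "\<exists>xs. (\<forall>x\<in>set xs. x > 0) \<and> p = root_poly xs"
  using assms
proof (induction "degree p" arbitrary: p)
  case 0
  then obtain c where "p = [:c:]" by (metis degree_eq_zeroE)
  with 0 show ?case by (intro exI[of _ "[]"]) auto
next
  case (Suc n)
  from Suc.hyps(2) have "degree p > 0" by simp
  then obtain z where z: "poly p z = 0" using alg_closed_imp_poly_has_root[of p] by auto
  with Suc.prems obtain t where t: "z = of_real t" "t > 0"
    by (metis Re_complex_of_real Reals_cases)
  from z obtain q where q: "p = [:-z, 1:] * q" by (auto simp: poly_eq_0_iff_dvd elim: dvdE)
  \<comment> \<open>Scaling the cofactor by \<open>-z\<close> turns the linear factor into
    \<open>1 - w / t\<close> and restores the value 1 at 0.\<close>
  define q' where "q' = smult (-z) q"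
  have pq: "p = [:1, - of_real (1 / t):] * q'"
    using t by (simp add: q q'_def algebra_simps)
  have "q \<noteq> 0" using q Suc.prems by auto
  hence "degree p = degree [:-z, 1:] + degree q" unfolding q by (intro degree_mult_eq) auto
  hence "degree q' = n" using Suc.hyps(2) t by (simp add: q'_def)
  moreover have "poly q' 0 = 1" using Suc.prems(1) by (simp add: pq)
  moreover have "w \<in> \<real> \<and> Re w > 0" if "poly q' w = 0" for w
    using Suc.prems(2)[of w] that by (simp add: pq)
  ultimately obtain xs where "\<forall>x\<in>set xs. x > 0" "q' = root_poly xs"
    using Suc.hyps(1) by blast
  then show ?case using t pq by (intro exI[of _ "(1 / t) # xs"]) auto
qed

text \<open>Factor by factor, \<open>norm (1 - x * z) \<ge> 1 - x * norm z \<ge> 0\<close>.\<close>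

lemma norm_root_poly_ge:
  assumes "\<forall>x\<in>set ys. 0 < x \<and> x * norm z \<le> 1"
  shows "Re (poly (root_poly ys) (of_real (norm z))) \<ge> 0"
    "norm (poly (root_poly ys) z) \<ge> Re (poly (root_poly ys) (of_real (norm z)))"
proof -
  have "poly (root_poly ys) (of_real (norm z)) = of_real (\<Prod>x\<leftarrow>ys. 1 - x * norm z)"
    by (induction ys) (simp_all add: algebra_simps)
  moreover have "(\<Prod>x\<leftarrow>ys. 1 - x * norm z) \<ge> 0 \<and>
      norm (poly (root_poly ys) z) \<ge> (\<Prod>x\<leftarrow>ys. 1 - x * norm z)"
    using assms
  proof (induction ys)
    case (Cons y ys)
    have "norm (1 - of_real y * z) \<ge> 1 - y * norm z"
      using norm_triangle_ineq2[of 1 "of_real y * z"] Cons.prems by (simp add: norm_mult)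
    moreover have "poly (root_poly (y # ys)) z = (1 - of_real y * z) * poly (root_poly ys) z"
      by (simp add: algebra_simps)
    ultimately show ?case using Cons by (auto simp: norm_mult intro!: mult_mono)
  qed simp
  ultimately show "Re (poly (root_poly ys) (of_real (norm z))) \<ge> 0"
    "norm (poly (root_poly ys) z) \<ge> Re (poly (root_poly ys) (of_real (norm z)))" by simp_all
qed

section \<open>The operators \<open>1 + a z d/dz\<close> and preservation of positive roots\<close>

definition euler_op :: "'a :: idom \<Rightarrow> 'a poly \<Rightarrow> 'a poly" where
  "euler_op a p = p + smult a (pCons 0 (pderiv p))"

text \<open>The operator is diagonal on monomials; this is how the factors of Euler's product enter
  the coefficients.\<close>

lemma coeff_euler_op: "coeff (euler_op a p) k = (1 + a * of_nat k) * coeff p k"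
  by (cases k) (simp_all add: euler_op_def coeff_pderiv algebra_simps)

lemma poly_euler_op: "poly (euler_op a p) z = poly p z + a * (z * poly (pderiv p) z)"
  by (simp add: euler_op_def algebra_simps)

text \<open>The logarithmic derivative of the product turns \<open>z P' / P\<close> into a sum over
  the factors.\<close>

lemma euler_op_root_poly_quotient:
  assumes "poly (root_poly xs) z \<noteq> 0"
  shows "poly (euler_op a (root_poly xs)) z / poly (root_poly xs) z =
           1 - a * (\<Sum>x\<leftarrow>xs. of_real x * z / (1 - of_real x * z))"
  using assms
proof (induction xs)
  case (Cons x xs)
  define P where "P = poly (root_poly xs) z"
  define D where "D = poly (pderiv (root_poly xs)) z"
  define S where "S = (\<Sum>x\<leftarrow>xs. of_real x * z / (1 - of_real x * z))"
  have nz: "1 - of_real x * z \<noteq> 0" "P \<noteq> 0" using Cons.prems by (auto simp: P_def algebra_simps)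
  have "(P + a * (z * D)) / P = 1 - a * S"
    using Cons.IH nz by (simp add: poly_euler_op P_def D_def S_def)
  hence "a * z * D = - a * S * P" using nz by (simp add: field_simps eq_neg_iff_add_eq_0)
  moreover have "poly (euler_op a (root_poly (x # xs))) z =
      (1 - of_real x * z) * P + (1 - of_real x * z) * (a * z * D) - a * z * of_real x * P"
    unfolding root_poly_simps poly_euler_op pderiv_mult
    by (simp add: pderiv_pCons P_def D_def algebra_simps)
  ultimately have "poly (euler_op a (root_poly (x # xs))) z =
      (1 - of_real x * z) * P - (1 - of_real x * z) * (a * S * P) - a * z * of_real x * P"
    by simp
  moreover have "poly (root_poly (x # xs)) z = (1 - of_real x * z) * P"
    by (simp add: P_def algebra_simps)
  ultimately show ?case using nz by (simp add: S_def[symmetric]) (simp add: field_simps)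
qed (simp add: euler_op_def)

text \<open>The sign of the imaginary part of \<open>w / (1 - w)\<close> is that of \<open>w\<close>, so the equation
  \<open>1 = a \<Sum> x z / (1 - x z)\<close> for the zeros has no non-real solution.\<close>

lemma euler_op_preserves_root_poly:
  assumes "a > 0" "\<forall>x\<in>set xs. x > 0"
  shows "\<exists>ys. (\<forall>y\<in>set ys. y > 0) \<and> euler_op (of_real a) (root_poly xs) = root_poly ys"
proof (rule root_poly_exists)
  show "poly (euler_op (of_real a) (root_poly xs)) 0 = 1" by (simp add: poly_euler_op)
next
  fix z assume z: "poly (euler_op (of_real a) (root_poly xs)) z = 0"
  show "z \<in> \<real> \<and> Re z > 0"
  proof (cases "poly (root_poly xs) z = 0")
    case True
    then obtain x where x: "x \<in> set xs" "of_real x * z = 1"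
      by (auto simp: poly_root_poly_eq_0_iff)
    hence "z = of_real (1 / x)" by (metis inverse_eq_divide inverse_unique of_real_inverse)
    then show ?thesis using x assms by auto
  next
    case False
    define T where "T x = of_real x * z / (1 - of_real x * z)" for x
    have *: "of_real a * (\<Sum>x\<leftarrow>xs. T x) = 1"
      using euler_op_root_poly_quotient[OF False, of "of_real a"] z by (simp add: T_def)
    have ne: "xs \<noteq> []" using * by auto
    have nz: "1 - of_real x * z \<noteq> 0" if "x \<in> set xs" for x
      using False that by (auto simp: poly_root_poly_eq_0_iff)
    have T_eq: "T x = of_real (x / (cmod (1 - of_real x * z))\<^sup>2) * (z - of_real x * of_real ((cmod z)\<^sup>2))" for x
    proof -
      have "T x = of_real x * z * cnj (1 - of_real x * z) / of_real ((cmod (1 - of_real x * z))\<^sup>2)"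
        unfolding T_def by (subst complex_div_cnj) simp
      also have "of_real x * z * cnj (1 - of_real x * z) = of_real x * (z - of_real x * of_real ((cmod z)\<^sup>2))"
        by (simp add: complex_norm_square algebra_simps del: of_real_power)
      finally show ?thesis by simp
    qed
    have Im_sum: "Im (\<Sum>x\<leftarrow>ys. T x) = Im z * (\<Sum>x\<leftarrow>ys. x / (cmod (1 - of_real x * z))\<^sup>2)" for ys
      by (induction ys) (simp_all add: T_eq algebra_simps)
    \<comment> \<open>This excludes zeros with \<open>Re z \<le> 0\<close>: every term would have
      nonpositive real part, while \<open>*\<close> requires the sum to be
      \<open>1 / a\<close>.\<close>
    have Re_sum: "Re (\<Sum>x\<leftarrow>ys. T x) \<le> 0" if "Re z \<le> 0" "set ys \<subseteq> set xs" for ys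
      using that(2)
    proof (induction ys)
      case (Cons y ys)
      have "y > 0" using Cons.prems assms by auto
      moreover have "y * (cmod z)\<^sup>2 \<ge> 0" using \<open>y > 0\<close> by simp
      ultimately have "Re z - y * (cmod z)\<^sup>2 \<le> 0" using that(1) by linarith
      moreover have "Re (T y) = y / (cmod (1 - of_real y * z))\<^sup>2 * (Re z - y * (cmod z)\<^sup>2)"
        unfolding T_eq by simp
      ultimately have "Re (T y) \<le> 0" using \<open>y > 0\<close>
        by (metis divide_nonneg_nonneg less_imp_le mult_nonneg_nonpos zero_le_power2)
      with Cons show ?case by simp
    qed simp
    have "(\<Sum>x\<leftarrow>xs. x / (cmod (1 - of_real x * z))\<^sup>2) > 0"
    proof -
      have "sum_list (map (\<lambda>x. x / (cmod (1 - of_real x * z))\<^sup>2) ys) > 0"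
        if "ys \<noteq> []" "set ys \<subseteq> set xs" for ys
        using that
      proof (induction ys)
        case (Cons y ys)
        have "y / (cmod (1 - of_real y * z))\<^sup>2 > 0" using Cons.prems nz assms by auto
        then show ?case using Cons by (cases "ys = []") auto
      qed simp
      with ne show ?thesis by blast
    qed
    moreover have "Im (of_real a * (\<Sum>x\<leftarrow>xs. T x)) = 0" using * by simp
    hence "Im (\<Sum>x\<leftarrow>xs. T x) = 0" using assms(1) by simp
    ultimately have "Im z = 0" unfolding Im_sum by simp
    moreover have "Re z > 0"
    proof (rule ccontr)
      assume "\<not> Re z > 0"
      hence "Re (\<Sum>x\<leftarrow>xs. T x) \<le> 0" using Re_sum by simp
      hence "Re (of_real a * (\<Sum>x\<leftarrow>xs. T x)) \<le> 0" using assms(1) by (simp add: mult_nonneg_nonpos)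
      thus False using * by simp
    qed
    ultimately show ?thesis by (simp add: complex_is_Real_iff)
  qed
qed

lemma foldr_euler_op_root_poly:
  assumes "\<forall>a\<in>set as. a > 0" "\<forall>x\<in>set xs. x > 0"
  shows "\<exists>ys. (\<forall>y\<in>set ys. y > 0) \<and>
           foldr (\<lambda>a. euler_op (of_real a)) as (root_poly xs) = root_poly ys"
  using assms(1)
proof (induction as)
  case (Cons a as)
  then obtain ys where "\<forall>y\<in>set ys. y > 0"
    "foldr (\<lambda>a. euler_op (of_real a)) as (root_poly xs) = root_poly ys" by auto
  with euler_op_preserves_root_poly[of a ys] Cons.prems show ?case by simp
qed (use assms(2) in auto)

lemma coeff_foldr_euler_op:
  "coeff (foldr (\<lambda>a. euler_op (of_real a)) as p) k =
     of_real (\<Prod>a\<leftarrow>as. 1 + a * of_nat k) * coeff p k"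
  by (induction as) (simp_all add: coeff_euler_op)

subsection \<open>Elementary symmetric functions and power sums\<close>

text \<open>Recursion on whether the head is chosen, in place of a sum over subsets, makes Newton's
  identities plain list inductions.\<close>

fun esym :: "nat \<Rightarrow> real list \<Rightarrow> real" where
  "esym 0 xs = 1"
| "esym (Suc k) [] = 0"
| "esym (Suc k) (x # xs) = esym (Suc k) xs + x * esym k xs"

definition psum :: "nat \<Rightarrow> real list \<Rightarrow> real" where
  "psum k xs = (\<Sum>x\<leftarrow>xs. x ^ k)"

lemma psum_simps [simp]: "psum k [] = 0" "psum k (x # xs) = x ^ k + psum k xs"
  by (simp_all add: psum_def)

lemma coeff_root_poly: "coeff (root_poly xs) k = of_real ((-1) ^ k * esym k xs)"
proof (induction k xs rule: esym.induct)
  case (1 xs)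
  show ?case by (simp flip: poly_0_coeff_0)
next
  case (3 k x xs)
  then show ?case by (simp add: algebra_simps)
qed simp

lemma esym_nonneg: "(\<forall>x\<in>set xs. x > 0) \<Longrightarrow> esym k xs \<ge> 0"
  by (induction k xs rule: esym.induct) auto

lemma psum_nonneg: "(\<forall>x\<in>set xs. x > 0) \<Longrightarrow> psum k xs \<ge> 0"
  by (induction xs) auto

lemma power_le_psum: "(\<forall>x\<in>set xs. x > 0) \<Longrightarrow> x \<in> set xs \<Longrightarrow> x ^ k \<le> psum k xs"
proof (induction xs)
  case (Cons y ys)
  then show ?case using psum_nonneg[of ys k] by (auto intro: add_increasing)
qed simp

text \<open>With \<open>M\<close> close to the largest inverse root this becomes an upper
  Euler-Rayleigh bound in the limit.\<close>

lemma psum_Suc_le: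
  "(\<forall>x\<in>set xs. 0 < x \<and> x \<le> M) \<Longrightarrow> psum (Suc k) xs \<le> M * psum k xs"
proof (induction xs)
  case (Cons y ys)
  have "y * y ^ k \<le> M * y ^ k" using Cons.prems by (intro mult_right_mono) auto
  moreover have "psum (Suc k) ys \<le> M * psum k ys" using Cons by simp
  ultimately show ?case by (simp add: algebra_simps)
qed simp

lemma newton_1: "psum (Suc 0) xs = esym 1 xs"
  by (induction xs) auto

lemma newton_2: "psum 2 xs = (esym 1 xs)\<^sup>2 - 2 * esym 2 xs"
  by (induction xs) (auto simp: algebra_simps power2_eq_square numeral_2_eq_2)

lemma newton_3: "psum 3 xs = (esym 1 xs) ^ 3 - 3 * esym 1 xs * esym 2 xs + 3 * esym 3 xs"
  by (induction xs) (auto simp: algebra_simps power2_eq_square numeral_2_eq_2 numeral_3_eq_3)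

text \<open>With \<open>P(z) = \<Prod>(1 - x z)\<close>, the left-hand side is up to sign the coefficient of \<open>z ^ (n + 2)\<close>
  in \<open>(1 - X z) P' + (p\<^sub>1 (1 - X z) + p\<^sub>2 z) P = P \<Sum> x\<^sup>2 z\<^sup>2 (X - x) / (1 - x z)\<close>.\<close>

lemma esym_recurrence_bound:
  assumes "\<forall>x\<in>set xs. x > 0"
  shows "\<bar>real (n + 3) * esym (n + 3) xs + (X * real (n + 2) - psum 1 xs) * esym (n + 2) xs
           - (X * psum 1 xs - psum 2 xs) * esym (n + 1) xs\<bar>
         \<le> (\<Sum>x\<leftarrow>xs. x\<^sup>2 * \<bar>X - x\<bar>) * esym n xs"
  using assms
proof (induction xs arbitrary: n)
  case (Cons x xs)
  define d where "d n = real (n + 3) * esym (n + 3) xs + (X * real (n + 2) - psum 1 xs) * esym (n + 2) xs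
           - (X * psum 1 xs - psum 2 xs) * esym (n + 1) xs" for n :: nat
  define W where "W = (\<Sum>x\<leftarrow>xs. x\<^sup>2 * \<bar>X - x\<bar>)"
  have x: "x > 0" and xs: "\<forall>x\<in>set xs. x > 0" using Cons.prems by auto
  have IH: "\<bar>d n\<bar> \<le> W * esym n xs" for n
    unfolding d_def W_def by (rule Cons.IH[OF xs])
  have W0: "W \<ge> 0" unfolding W_def by (rule sum_list_nonneg) auto
  have E0: "esym k xs \<ge> 0" for k using esym_nonneg[OF xs] .
  show ?case
  proof (cases n)
    \<comment> \<open>The general step uses the defect \<open>d\<close> at \<open>n - 1\<close>. For
      \<open>n = 0\<close> this would be \<open>2 e2 - p1 e1 + p2\<close>, which is 0 by Newton's
      identities.\<close>
    case 0
    have "real (0 + 3) * esym (0 + 3) (x # xs) + (X * real (0 + 2) - psum 1 (x # xs)) * esym (0 + 2) (x # xs)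
           - (X * psum 1 (x # xs) - psum 2 (x # xs)) * esym (0 + 1) (x # xs) =
           d 0 - x\<^sup>2 * (X - x) * esym 0 xs"
      by (simp add: d_def eval_nat_numeral newton_1 newton_2[unfolded numeral_2_eq_2] algebra_simps)
    moreover have "\<bar>x\<^sup>2 * (X - x) * esym 0 xs\<bar> = x\<^sup>2 * \<bar>X - x\<bar> * esym 0 xs"
      by (simp add: abs_mult)
    hence "\<bar>d 0 - x\<^sup>2 * (X - x) * esym 0 xs\<bar> \<le> W * esym 0 xs + x\<^sup>2 * \<bar>X - x\<bar> * esym 0 xs"
      using IH[of 0] by linarith
    ultimately show ?thesis by (simp add: 0 W_def)
  next
    case (Suc m)
    have "real (n + 3) * esym (n + 3) (x # xs) + (X * real (n + 2) - psum 1 (x # xs)) * esym (n + 2) (x # xs)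
           - (X * psum 1 (x # xs) - psum 2 (x # xs)) * esym (n + 1) (x # xs) =
           d n + x * d m - x\<^sup>2 * (X - x) * esym n xs"
      by (simp add: d_def Suc eval_nat_numeral algebra_simps)
    moreover have "\<bar>d n + x * d m - x\<^sup>2 * (X - x) * esym n xs\<bar>
       \<le> W * esym n xs + x * (W * esym m xs) + x\<^sup>2 * \<bar>X - x\<bar> * esym n xs"
    proof -
      have "\<bar>x * d m\<bar> \<le> x * (W * esym m xs)" using IH[of m] x by (simp add: abs_mult)
      moreover have "\<bar>x\<^sup>2 * (X - x) * esym n xs\<bar> = x\<^sup>2 * \<bar>X - x\<bar> * esym n xs"
        using E0 by (simp add: abs_mult)
      ultimately show ?thesis using IH[of n] by linarith
    qed
    \<comment> \<open>Adding this term completes \<open>esym n xs\<close> to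
      \<open>esym n (x # xs)\<close> in the weight contributed by the head.\<close>
    moreover have "x\<^sup>2 * \<bar>X - x\<bar> * (x * esym m xs) \<ge> 0" using x E0 by simp
    ultimately show ?thesis by (simp add: Suc W_def algebra_simps)
  qed
qed (simp add: eval_nat_numeral)

subsection \<open>Euler-Rayleigh inequalities for limits of polynomials with positive roots\<close>

text \<open>Locally uniform convergence carries information on the roots to \<open>F\<close>;
  convergence of the coefficients carries it to the power sums.\<close>

locale root_poly_limit =
  fixes xs :: "nat \<Rightarrow> real list" and F :: "complex \<Rightarrow> complex" and e :: "nat \<Rightarrow> real"
  assumes pos: "\<And>N x. x \<in> set (xs N) \<Longrightarrow> x > 0"
    and unif: "\<And>R. uniform_limit (cball 0 R) (\<lambda>N. poly (root_poly (xs N))) F sequentially"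
    and esym_lim: "\<And>k. (\<lambda>N. esym k (xs N)) \<longlonglongrightarrow> e k"
begin

lemma pointwise: "(\<lambda>N. poly (root_poly (xs N)) z) \<longlonglongrightarrow> F z"
  by (rule tendsto_uniform_limitI[OF unif[of "norm z"]]) simp

lemma F_0 [simp]: "F 0 = 1"
  using LIMSEQ_unique[OF pointwise[of 0]] by simp

lemma holomorphic: "F holomorphic_on A"
proof -
  have "F holomorphic_on ball 0 R" for R
    by (rule holomorphic_uniform_limit[OF _ unif[of R]])
       (auto intro!: always_eventually continuous_intros holomorphic_intros)
  hence "F holomorphic_on (\<Union>R. ball 0 R)" by (intro holomorphic_on_UN_open) auto
  moreover have "(\<Union>R. ball (0::complex) R) = UNIV"
    using gt_ex by auto
  ultimately show ?thesis using holomorphic_on_subset by blast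
qed

lemma continuous: "continuous_on A F"
  using holomorphic holomorphic_on_imp_continuous_on by blast

text \<open>On the compact segment from 0 to \<open>s\<close> the modulus of \<open>F\<close> has a
  positive minimum; approximants closer to \<open>F\<close> than this minimum do not vanish
  there.\<close>

lemma eventually_roots_less:
  assumes "s > 0" "\<And>t. 0 < t \<Longrightarrow> t \<le> s \<Longrightarrow> F (of_real t) \<noteq> 0"
  shows "eventually (\<lambda>N. \<forall>x\<in>set (xs N). x < 1 / s) sequentially"
proof -
  define K where "K = complex_of_real ` {0..s}"
  have K: "compact K" unfolding K_def by (intro compact_continuous_image continuous_intros) auto
  have K0: "0 \<in> K" using assms(1) by (auto simp: K_def image_iff)
  obtain m where m: "m \<in> K" "\<And>z. z \<in> K \<Longrightarrow> norm (F m) \<le> norm (F z)"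
    using continuous_attains_inf[OF K, of "\<lambda>z. norm (F z)"] K0
    by (metis continuous continuous_on_norm empty_iff)
  have "norm (F m) > 0"
  proof -
    from m obtain t where t: "m = of_real t" "0 \<le> t" "t \<le> s" by (auto simp: K_def)
    show ?thesis using assms(2)[of t] t by (cases "t = 0") auto
  qed
  with unif[of s] have "eventually (\<lambda>N. \<forall>z\<in>cball 0 s.
      dist (poly (root_poly (xs N)) z) (F z) < norm (F m)) sequentially"
    by (auto simp: uniform_limit_iff)
  thus ?thesis
  proof eventually_elim
    case (elim N)
    show ?case
    proof (intro ballI, rule ccontr)
      fix x assume x: "x \<in> set (xs N)" "\<not> x < 1 / s"
      have x0: "x > 0" using pos x by blast
      have le: "1 / x \<le> s" using x x0 assms(1) by (simp add: field_simps)
      have z: "of_real (1 / x) \<in> K" using x0 le unfolding K_def by (intro imageI) auto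
      have "norm (of_real (1 / x) :: complex) \<le> s" using x0 le by (simp only: norm_of_real) simp
      hence "of_real (1 / x) \<in> cball (0::complex) s" by simp
      moreover have "poly (root_poly (xs N)) (of_real (1 / x)) = 0"
        using x x0 by (auto simp: poly_root_poly_eq_0_iff intro!: bexI[of _ x])
      ultimately have "norm (F (of_real (1 / x))) < norm (F m)"
        using elim by (metis dist_0_norm)
      with m(2)[OF z] show False by simp
    qed
  qed
qed

text \<open>Otherwise a subsequence has no zero in the disc of radius \<open>r + \<epsilon>\<close>,
  and Hurwitz's theorem forbids a zero of the limit, which is not constant as
  \<open>F 0 = 1\<close>.\<close>

lemma eventually_roots_greater:
  assumes "F (of_real r) = 0" "r > 0" "\<epsilon> > 0"
  shows "eventually (\<lambda>N. \<exists>x\<in>set (xs N). x > 1 / (r + \<epsilon>)) sequentially"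
proof (rule ccontr)
  assume "\<not> ?thesis"
  hence "\<forall>n. \<exists>m\<ge>n. \<forall>x\<in>set (xs m). x \<le> 1 / (r + \<epsilon>)"
    by (auto simp: eventually_sequentially not_less)
  then obtain f where f: "\<And>n. f n \<ge> n" "\<And>n. \<forall>x\<in>set (xs (f n)). x \<le> 1 / (r + \<epsilon>)" by metis
  have f_top: "filterlim f at_top sequentially"
    using f(1) by (auto simp: filterlim_at_top eventually_sequentially intro: order_trans)
  have "F (of_real r) \<noteq> 0"
  proof (rule Hurwitz_no_zeros[of "ball 0 (r + \<epsilon>)" "\<lambda>n. poly (root_poly (xs (f n)))" F])
    show "uniform_limit K (\<lambda>n. poly (root_poly (xs (f n)))) F sequentially"
      if "compact K" "K \<subseteq> ball 0 (r + \<epsilon>)" for K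
    proof -
      obtain R where "K \<subseteq> cball 0 R"
        using compact_imp_bounded[OF \<open>compact K\<close>] by (auto simp: bounded_iff subset_iff)
      have "uniform_limit (cball 0 R) (\<lambda>n. poly (root_poly (xs (f n)))) F sequentially"
        using f_top unif[of R] by (rule filterlim_compose[rotated])
      thus ?thesis using \<open>K \<subseteq> cball 0 R\<close> uniform_limit_on_subset by blast
    qed
    show "\<not> F constant_on ball 0 (r + \<epsilon>)"
    proof
      assume "F constant_on ball 0 (r + \<epsilon>)"
      then obtain c where c: "\<And>z. z \<in> ball 0 (r + \<epsilon>) \<Longrightarrow> F z = c" by (auto simp: constant_on_def)
      show False using c[of 0] c[of "of_real r"] assms by simp
    qed
    show "poly (root_poly (xs (f n))) z \<noteq> 0" if "z \<in> ball 0 (r + \<epsilon>)" for n z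
    proof
      assume "poly (root_poly (xs (f n))) z = 0"
      then obtain x where x: "x \<in> set (xs (f n))" "of_real x * z = 1"
        by (auto simp: poly_root_poly_eq_0_iff)
      hence "x * norm z = 1" using pos[OF x(1)]
        by (metis abs_of_pos norm_mult norm_of_real norm_one)
      moreover have "x \<le> 1 / (r + \<epsilon>)" using f(2) x by blast
      moreover have "x * norm z < x * (r + \<epsilon>)" using that pos[OF x(1)] by simp
      moreover have "x * (r + \<epsilon>) \<le> 1 / (r + \<epsilon>) * (r + \<epsilon>)"
        using calculation(2) assms by (intro mult_right_mono) auto
      ultimately show False using assms by simp
    qed
    show "of_real r \<in> ball (0::complex) (r + \<epsilon>)" using assms by simp
  qed (auto intro!: holomorphic_intros holomorphic)
  with assms show False by simp
qed

text \<open>Newton's expressions for the first three power sums, in the limit coefficients; no sum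
  over the zeros of \<open>F\<close> is involved.\<close>

definition s1 where "s1 = e 1"
definition s2 where "s2 = (e 1)\<^sup>2 - 2 * e 2"
definition s3 where "s3 = (e 1) ^ 3 - 3 * e 1 * e 2 + 3 * e 3"

lemma psum_lim:
  "(\<lambda>N. psum 1 (xs N)) \<longlonglongrightarrow> s1" "(\<lambda>N. psum 2 (xs N)) \<longlonglongrightarrow> s2" "(\<lambda>N. psum 3 (xs N)) \<longlonglongrightarrow> s3"
proof -
  show "(\<lambda>N. psum 1 (xs N)) \<longlonglongrightarrow> s1" using esym_lim[of 1] by (simp add: s1_def newton_1)
  show "(\<lambda>N. psum 2 (xs N)) \<longlonglongrightarrow> s2" unfolding s2_def newton_2 by (intro tendsto_intros esym_lim)
  show "(\<lambda>N. psum 3 (xs N)) \<longlonglongrightarrow> s3" unfolding s3_def newton_3 by (intro tendsto_intros esym_lim)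
qed

lemma s2_nonneg: "s2 \<ge> 0"
  by (rule tendsto_lowerbound[OF psum_lim(2)]) (auto intro!: always_eventually psum_nonneg pos)

text \<open>Up to the first positive zero \<open>norm_root_poly_ge\<close> eventually applies to the
  approximants, and it survives the limit.\<close>

lemma norm_F_ge:
  assumes "\<And>t. 0 < t \<Longrightarrow> t \<le> norm z \<Longrightarrow> F (of_real t) \<noteq> 0"
  shows "norm (F z) \<ge> Re (F (of_real (norm z)))" "Re (F (of_real (norm z))) \<ge> 0"
proof -
  have ev: "eventually (\<lambda>N. \<forall>x\<in>set (xs N). 0 < x \<and> x * norm z \<le> 1) sequentially"
  proof (cases "z = 0")
    case False
    hence "norm z > 0" by simp
    hence "eventually (\<lambda>N. \<forall>x\<in>set (xs N). x < 1 / norm z) sequentially"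
      by (rule eventually_roots_less) (rule assms)
    thus ?thesis
    proof eventually_elim
      case (elim N)
      show ?case
      proof
        fix x assume x: "x \<in> set (xs N)"
        with elim have "x < 1 / norm z" by blast
        with False pos[OF x] show "0 < x \<and> x * norm z \<le> 1" by (simp add: field_simps)
      qed
    qed
  qed (use pos in auto)
  show "norm (F z) \<ge> Re (F (of_real (norm z)))"
    by (rule tendsto_le[OF _ tendsto_norm[OF pointwise] tendsto_Re[OF pointwise]])
       (use ev in \<open>auto elim!: eventually_mono intro!: norm_root_poly_ge\<close>)
  show "Re (F (of_real (norm z))) \<ge> 0"
    by (rule tendsto_lowerbound[OF tendsto_Re[OF pointwise]])
       (use ev in \<open>auto elim!: eventually_mono intro!: norm_root_poly_ge\<close>)
qed

lemma F_of_real: "F (of_real t) \<in> \<real>"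
proof -
  have "poly (root_poly ys) (of_real t) \<in> \<real>" for ys
    by (induction ys) auto
  thus ?thesis
    using closed_sequentially[OF closed_complex_Reals _ pointwise[of "of_real t"]] by blast
qed

end

text \<open>For \<open>exp (- a z)\<close> the quotients in \<open>e_ratio\<close> are constantly
  \<open>a\<close>; the limit 0 demands faster decay and is what makes the later inequalities
  strict.\<close>

locale root_poly_limit_fast = root_poly_limit +
  assumes e_pos: "\<And>k. e k > 0"
    and e_ratio: "(\<lambda>k. real (k + 1) * e (k + 1) / e k) \<longlonglongrightarrow> 0"
begin

text \<open>The limit of the weighted sums of \<open>\<bar>X - x\<bar>\<close> vanishes only if \<open>F\<close> is of the form
  \<open>exp (- a z) (1 - X z) ^ m\<close>, whose coefficients do not decay fast enough.\<close>

lemma not_degenerate: "\<not> (\<lambda>N. \<Sum>x\<leftarrow>xs N. x\<^sup>2 * \<bar>X - x\<bar>) \<longlonglongrightarrow> 0"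
proof
  assume W: "(\<lambda>N. \<Sum>x\<leftarrow>xs N. x\<^sup>2 * \<bar>X - x\<bar>) \<longlonglongrightarrow> 0"
  define u where "u k = real (k + 1) * e (k + 1) / e k" for k
  have u: "u \<longlonglongrightarrow> 0" using e_ratio unfolding u_def .
  define c where "c = X * s1 - s2"
  \<comment> \<open>The defect in \<open>esym_recurrence_bound\<close> is at most the weighted sum
    times \<open>esym n\<close>, so the recurrence is exact in the limit.\<close>
  have rec: "real (n + 3) * e (n + 3) + (X * real (n + 2) - s1) * e (n + 2) = c * e (n + 1)" for n
  proof -
    define d where "d N = real (n + 3) * esym (n + 3) (xs N)
       + (X * real (n + 2) - psum 1 (xs N)) * esym (n + 2) (xs N)
       - (X * psum 1 (xs N) - psum 2 (xs N)) * esym (n + 1) (xs N)" for N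
    have "d \<longlonglongrightarrow> real (n + 3) * e (n + 3) + (X * real (n + 2) - s1) * e (n + 2) - c * e (n + 1)"
      unfolding d_def c_def by (intro tendsto_intros esym_lim psum_lim)
    moreover have "d \<longlonglongrightarrow> 0"
    proof (rule Lim_null_comparison)
      show "eventually (\<lambda>N. norm (d N) \<le> (\<Sum>x\<leftarrow>xs N. x\<^sup>2 * \<bar>X - x\<bar>) * esym n (xs N)) sequentially"
        unfolding d_def using esym_recurrence_bound pos by (intro always_eventually) simp
      show "(\<lambda>N. (\<Sum>x\<leftarrow>xs N. x\<^sup>2 * \<bar>X - x\<bar>) * esym n (xs N)) \<longlonglongrightarrow> 0"
        using tendsto_mult[OF W esym_lim[of n]] by simp
    qed
    ultimately show ?thesis using LIMSEQ_unique by fastforce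
  qed
  have e_nz: "e k \<noteq> 0" for k using e_pos[of k] by simp
  have u1: "(\<lambda>n. u (n + 1)) \<longlonglongrightarrow> 0" and u2: "(\<lambda>n. u (n + 2)) \<longlonglongrightarrow> 0"
    and u3: "(\<lambda>n. u (n + 3)) \<longlonglongrightarrow> 0" using u by (rule LIMSEQ_ignore_initial_segment)+
  have inv: "(\<lambda>n. 1 / real (n + 2)) \<longlonglongrightarrow> 0"
    using LIMSEQ_ignore_initial_segment[OF lim_1_over_n, of 2] by simp
  \<comment> \<open>Division by \<open>e (n + 1)\<close> rewrites the recurrence in the quotients
    \<open>u\<close>; as these tend to 0, so does the left-hand side, and
    \<open>c = 0\<close>.\<close>
  have c_eq: "u (n + 2) * u (n + 1) * (1 / real (n + 2)) + X * u (n + 1) - s1 * u (n + 1) * (1 / real (n + 2)) = c" for n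
  proof -
    have "c = (real (n + 3) * e (n + 3) + (X * real (n + 2) - s1) * e (n + 2)) / e (n + 1)"
      using rec[of n] e_nz[of "n + 1"] by (simp add: field_simps)
    also have "\<dots> = real (n + 3) * e (n + 3) / e (n + 1) + X * (real (n + 2) * e (n + 2) / e (n + 1))
                    - s1 * (e (n + 2) / e (n + 1))"
      using e_nz[of "n + 1"] by (simp add: field_simps)
    also have "real (n + 2) * e (n + 2) / e (n + 1) = u (n + 1)"
      by (simp add: u_def eval_nat_numeral)
    also have "e (n + 2) / e (n + 1) = u (n + 1) * (1 / real (n + 2))"
      by (simp add: u_def eval_nat_numeral del: of_nat_Suc)
    also have "real (n + 3) * e (n + 3) / e (n + 1) = u (n + 2) * (e (n + 2) / e (n + 1))"
      using e_nz[of "n + 2"] by (simp add: u_def eval_nat_numeral)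
    also have "e (n + 2) / e (n + 1) = u (n + 1) * (1 / real (n + 2))"
      by (simp add: u_def eval_nat_numeral del: of_nat_Suc)
    finally show ?thesis by (simp only: mult.assoc)
  qed
  have "(\<lambda>n. u (n + 2) * u (n + 1) * (1 / real (n + 2)) + X * u (n + 1) - s1 * u (n + 1) * (1 / real (n + 2)))
           \<longlonglongrightarrow> 0 * 0 * 0 + X * 0 - s1 * 0 * 0"
    by (intro tendsto_intros u1 u2 inv)
  hence "c = 0" unfolding c_eq using LIMSEQ_unique[OF tendsto_const] by fastforce
  \<comment> \<open>Now \<open>u\<close> is affine with slope \<open>- X\<close>. Its limit 0 forces
    \<open>X = 0\<close> and then \<open>s1 = 0\<close>, against \<open>e 1 > 0\<close>.\<close>
  have u_eq: "u (n + 2) = s1 - X * real (n + 2)" for n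
    using rec[of n] e_nz[of "n + 2"] by (simp add: \<open>c = 0\<close> u_def field_simps eval_nat_numeral)
  have "(\<lambda>n. u (n + 2) - u (n + 3)) \<longlonglongrightarrow> 0 - 0" by (intro tendsto_intros u2 u3)
  moreover have "u (n + 2) - u (n + 3) = X" for n
    using u_eq[of n] u_eq[of "n + 1"] by (simp add: algebra_simps eval_nat_numeral)
  ultimately have "X = 0" using LIMSEQ_unique[OF tendsto_const] by fastforce
  hence "s1 = 0" using u2 unfolding u_eq using LIMSEQ_unique[OF tendsto_const] by fastforce
  thus False using e_pos[of 1] by (simp add: s1_def)
qed

text \<open>If \<open>s2\<close> vanished, so would \<open>s3\<close>, by
  \<open>psum 3 \<le> psum 1 * psum 2\<close>; but \<open>psum 3\<close> is the weighted sum of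
  \<open>not_degenerate\<close> with \<open>X = 0\<close>.\<close>

lemma s2_pos: "s2 > 0"
proof (rule ccontr)
  assume "\<not> s2 > 0"
  hence "s2 = 0" using s2_nonneg by simp
  have "psum 3 (xs N) \<le> psum 1 (xs N) * psum 2 (xs N)" for N
    using psum_Suc_le[of "xs N" "psum 1 (xs N)" 2] power_le_psum[of "xs N" _ 1] pos
    by (simp add: eval_nat_numeral)
  hence "s3 \<le> s1 * s2"
    by (intro tendsto_le[OF _ tendsto_mult[OF psum_lim(1,2)] psum_lim(3)]) auto
  moreover have "s3 \<ge> 0"
    by (rule tendsto_lowerbound[OF psum_lim(3)]) (auto intro!: always_eventually psum_nonneg pos)
  ultimately have "s3 = 0" using \<open>s2 = 0\<close> by simp
  moreover have "(\<Sum>x\<leftarrow>xs N. x\<^sup>2 * \<bar>0 - x\<bar>) = psum 3 (xs N)" for N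
    unfolding psum_def using pos[of _ N]
    by (intro arg_cong[of _ _ sum_list] map_cong)
       (auto simp: eval_nat_numeral abs_of_pos simp del: abs_of_nonneg)
  ultimately show False using not_degenerate[of 0] psum_lim(3) by simp
qed

text \<open>Without a root the inverse roots of the approximants tend to 0 uniformly, so
  \<open>s2 \<le> s1 / s\<close> for every \<open>s > 0\<close>; at \<open>s = 2 * s1 / s2\<close>
  this reads \<open>s2 \<le> s2 / 2\<close>.\<close>

lemma has_root: "\<exists>t>0. F (of_real t) = 0"
proof (rule ccontr)
  assume "\<not> ?thesis"
  hence nz: "F (of_real t) \<noteq> 0" if "t > 0" for t using that by blast
  have *: "s2 \<le> 1 / s * s1" if s: "s > 0" for s
  proof (rule tendsto_le[OF _ tendsto_mult[OF tendsto_const psum_lim(1)] psum_lim(2)])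
    have "eventually (\<lambda>N. \<forall>x\<in>set (xs N). x < 1 / s) sequentially"
      by (rule eventually_roots_less[OF s]) (rule nz)
    thus "eventually (\<lambda>N. psum 2 (xs N) \<le> 1 / s * psum 1 (xs N)) sequentially"
    proof eventually_elim
      case (elim N)
      then show ?case using psum_Suc_le[of "xs N" "1 / s" 1] pos by (auto simp: eval_nat_numeral less_imp_le)
    qed
  qed simp
  have s1: "s1 > 0" using e_pos by (simp add: s1_def)
  show False using *[of "2 * s1 / s2"] s1 s2_pos by (simp add: field_simps)
qed

lemma smallest_root_exists:
  obtains r where "r > 0" "F (of_real r) = 0" "\<And>t. 0 < t \<Longrightarrow> t < r \<Longrightarrow> F (of_real t) \<noteq> 0"
proof -
  obtain b where b: "b > 0" "F (of_real b) = 0" using has_root by blast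
  define Z where "Z = {0..b} \<inter> (\<lambda>t. F (of_real t)) -` {0}"
  have "closed Z" unfolding Z_def
    by (intro continuous_closed_preimage continuous_on_compose2[OF continuous[of UNIV]] continuous_intros) auto
  hence "compact Z" unfolding Z_def compact_eq_bounded_closed
    by (auto intro: bounded_subset[of "{0..b}"])
  moreover have "b \<in> Z" using b by (simp add: Z_def)
  hence "Z \<noteq> {}" by blast
  ultimately obtain r where r: "r \<in> Z" "\<And>t. t \<in> Z \<Longrightarrow> r \<le> t"
    using compact_attains_inf[of Z] by blast
  show ?thesis
  proof (rule that[of r])
    show "F (of_real r) = 0" using r by (simp add: Z_def)
    thus "r > 0" using r by (cases "r = 0") (auto simp: Z_def)
    show "F (of_real t) \<noteq> 0" if "0 < t" "t < r" for t
      using r(2)[of t] r(1) that by (auto simp: Z_def)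
  qed
qed

section \<open>Strict Euler-Rayleigh bounds for the smallest positive root\<close>

context
  fixes r :: real
  assumes r: "r > 0" "F (of_real r) = 0" "\<And>t. 0 < t \<Longrightarrow> t < r \<Longrightarrow> F (of_real t) \<noteq> 0"
begin

lemma eventually_roots_le:
  assumes "\<delta> > 0"
  shows "eventually (\<lambda>N. \<forall>x\<in>set (xs N). x \<le> 1 / r + \<delta>) sequentially"
proof -
  define s where "s = 1 / (1 / r + \<delta>)"
  have "1 / r > 0" using r by simp
  hence "s < 1 / (1 / r)" unfolding s_def using assms by (intro divide_strict_left_mono mult_pos_pos add_pos_pos) auto
  hence s: "s < r" by simp
  have s0: "s > 0" unfolding s_def using \<open>1 / r > 0\<close> assms by (intro divide_pos_pos add_pos_pos) auto
  have "eventually (\<lambda>N. \<forall>x\<in>set (xs N). x < 1 / s) sequentially"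
    using s0 by (rule eventually_roots_less) (rule r(3), use s in auto)
  moreover have "1 / s = 1 / r + \<delta>" by (simp add: s_def)
  ultimately show ?thesis by (auto elim!: eventually_mono simp: less_imp_le)
qed

text \<open>A single inverse root above \<open>1 / (r + \<epsilon>)\<close> already accounts for the
  bound; then \<open>\<epsilon>\<close> tends to 0.\<close>

lemma psum_lower:
  assumes "(\<lambda>N. psum k (xs N)) \<longlonglongrightarrow> s"
  shows "(1 / r) ^ k \<le> s"
proof -
  have *: "(1 / (r + \<epsilon>)) ^ k \<le> s" if e: "\<epsilon> > 0" for \<epsilon>
  proof (rule tendsto_lowerbound[OF assms])
    from eventually_roots_greater[OF r(2,1) e]
    show "eventually (\<lambda>N. (1 / (r + \<epsilon>)) ^ k \<le> psum k (xs N)) sequentially"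
    proof eventually_elim
      case (elim N)
      then obtain x where x: "x \<in> set (xs N)" "x > 1 / (r + \<epsilon>)" by blast
      have "(1 / (r + \<epsilon>)) ^ k \<le> x ^ k" using x r e by (intro power_mono) auto
      also have "\<dots> \<le> psum k (xs N)" using x pos by (intro power_le_psum) auto
      finally show ?case .
    qed
  qed simp
  have "((\<lambda>\<epsilon>. (1 / (r + \<epsilon>)) ^ k) \<longlongrightarrow> (1 / (r + 0)) ^ k) (at_right 0)"
    using r by (intro tendsto_intros) auto
  moreover have "eventually (\<lambda>\<epsilon>. (1 / (r + \<epsilon>)) ^ k \<le> s) (at_right 0)"
    using eventually_at_right_less[of "0::real"] by eventually_elim (rule *)
  ultimately have "(1 / (r + 0)) ^ k \<le> s" by (rule tendsto_upperbound) simp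
  thus ?thesis by simp
qed

lemma psum_upper:
  assumes "(\<lambda>N. psum k (xs N)) \<longlonglongrightarrow> s" "(\<lambda>N. psum (Suc k) (xs N)) \<longlonglongrightarrow> s'"
  shows "s' \<le> (1 / r) * s"
proof -
  have *: "s' \<le> (1 / r + \<epsilon>) * s" if e: "\<epsilon> > 0" for \<epsilon>
  proof (rule tendsto_le[OF _ tendsto_mult[OF tendsto_const assms(1)] assms(2)])
    from eventually_roots_le[OF e]
    show "eventually (\<lambda>N. psum (Suc k) (xs N) \<le> (1 / r + \<epsilon>) * psum k (xs N)) sequentially"
      by eventually_elim (rule psum_Suc_le, use pos in auto)
  qed simp
  have "((\<lambda>\<epsilon>. (1 / r + \<epsilon>) * s) \<longlongrightarrow> (1 / r + 0) * s) (at_right 0)"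
    by (intro tendsto_intros)
  moreover have "eventually (\<lambda>\<epsilon>. (1 / r + \<epsilon>) * s \<ge> s') (at_right 0)"
    using eventually_at_right_less[of "0::real"] by eventually_elim (rule *)
  ultimately have "s' \<le> (1 / r + 0) * s" by (rule tendsto_lowerbound) simp
  thus ?thesis by simp
qed

text \<open>Equality would make the weighted sum of \<open>not_degenerate\<close> vanish for
  \<open>X = 1 / r\<close>: eventually no inverse root exceeds \<open>1 / r\<close> by more than
  \<open>\<delta>\<close>, so up to a small error the sum is
  \<open>psum 2 / r - psum 3\<close>.\<close>

lemma s3_less: "s3 < s2 / r"
proof (rule ccontr)
  assume "\<not> s3 < s2 / r"
  hence eq: "s3 = s2 / r" using psum_upper[of 2] psum_lim(2,3) by (fastforce simp: eval_nat_numeral)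
  have "(\<lambda>N. \<Sum>x\<leftarrow>xs N. x\<^sup>2 * \<bar>1 / r - x\<bar>) \<longlonglongrightarrow> 0"
  proof (rule tendstoI)
    fix \<eta> :: real assume \<eta>: "\<eta> > 0"
    \<comment> \<open>With this choice and \<open>s3 = s2 / r\<close> the bound below tends to
      \<open>2 * \<delta> * s2 = \<eta> / 2\<close>.\<close>
    define \<delta> where "\<delta> = \<eta> / (4 * s2)"
    have \<delta>: "\<delta> > 0" "2 * \<delta> * s2 < \<eta>" using \<eta> s2_pos by (auto simp: \<delta>_def field_simps)
    have "(\<lambda>N. (1 / r + 2 * \<delta>) * psum 2 (xs N) - psum 3 (xs N)) \<longlonglongrightarrow> (1 / r + 2 * \<delta>) * s2 - s3"
      by (intro tendsto_intros psum_lim)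
    moreover have "(1 / r + 2 * \<delta>) * s2 - s3 < \<eta>" using \<delta> by (simp add: eq algebra_simps)
    ultimately have "eventually (\<lambda>N. (1 / r + 2 * \<delta>) * psum 2 (xs N) - psum 3 (xs N) < \<eta>) sequentially"
      by (rule order_tendstoD)
    with eventually_roots_le[OF \<delta>(1)]
    show "eventually (\<lambda>N. dist (\<Sum>x\<leftarrow>xs N. x\<^sup>2 * \<bar>1 / r - x\<bar>) 0 < \<eta>) sequentially"
    proof eventually_elim
      case (elim N)
      have "(\<Sum>x\<leftarrow>ys. x\<^sup>2 * \<bar>1 / r - x\<bar>) \<le> (1 / r + 2 * \<delta>) * psum 2 ys - psum 3 ys"
        if "\<forall>x\<in>set ys. x \<le> 1 / r + \<delta>" for ys
        using that
      proof (induction ys)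
        case (Cons y ys)
        \<comment> \<open>Removing the absolute value costs twice the excess
          \<open>y - 1 / r\<close>, hence the slack \<open>2 * \<delta>\<close>.\<close>
        have "\<bar>1 / r - y\<bar> \<le> 1 / r + 2 * \<delta> - y" using Cons.prems \<delta>(1) by auto
        hence "y\<^sup>2 * \<bar>1 / r - y\<bar> \<le> y\<^sup>2 * (1 / r + 2 * \<delta> - y)" by (intro mult_left_mono) auto
        moreover have "y\<^sup>2 * (1 / r + 2 * \<delta> - y) = (1 / r + 2 * \<delta>) * y\<^sup>2 - y ^ 3"
          by (simp add: algebra_simps power2_eq_square power3_eq_cube)
        ultimately show ?case using Cons by (simp add: distrib_left)
      qed simp
      from this[OF elim(1)] elim(2) have "(\<Sum>x\<leftarrow>xs N. x\<^sup>2 * \<bar>1 / r - x\<bar>) < \<eta>" by linarith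
      moreover have "(\<Sum>x\<leftarrow>xs N. x\<^sup>2 * \<bar>1 / r - x\<bar>) \<ge> 0" by (rule sum_list_nonneg) auto
      ultimately show ?case by simp
    qed
  qed
  thus False using not_degenerate by blast
qed

text \<open>By Cauchy-Schwarz, equality would give
  \<open>s2\<^sup>2 \<le> s1 * s3 < s1 * s2 / r = s2\<^sup>2\<close>; strictness is inherited from
  \<open>s3_less\<close>.\<close>

lemma s2_less: "s2 < s1 / r"
proof (rule ccontr)
  assume "\<not> s2 < s1 / r"
  hence eq: "s2 = s1 / r" using psum_upper[of 1] psum_lim(1,2) by (fastforce simp: eval_nat_numeral)
  have s1: "s1 > 0" using e_pos by (simp add: s1_def)
  have cs: "(psum 2 ys)\<^sup>2 \<le> psum 1 ys * psum 3 ys" if "\<forall>x\<in>set ys. x > 0" for ys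
  proof -
    \<comment> \<open>This is \<open>\<Sum> x (x - t)\<^sup>2 \<ge> 0\<close>; taking
      \<open>t = psum 2 ys / psum 1 ys\<close> yields Cauchy-Schwarz.\<close>
    have "psum 3 ys - 2 * t * psum 2 ys + t\<^sup>2 * psum 1 ys \<ge> 0" for t
      using that
    proof (induction ys)
      case (Cons y ys)
      have "y ^ 3 - 2 * t * y\<^sup>2 + t\<^sup>2 * y = y * (y - t)\<^sup>2"
        by (simp add: power2_eq_square power3_eq_cube algebra_simps)
      moreover have "y * (y - t)\<^sup>2 \<ge> 0" using Cons.prems by auto
      ultimately have "y ^ 3 - 2 * t * y\<^sup>2 + t\<^sup>2 * y \<ge> 0" by simp
      moreover have "psum 3 ys - 2 * t * psum 2 ys + t\<^sup>2 * psum 1 ys \<ge> 0" using Cons by simp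
      ultimately show ?case by (simp add: algebra_simps)
    qed simp
    note * = this
    show ?thesis
    proof (cases "ys = []")
      case False
      hence "psum 1 ys > 0" using that
        by (cases ys) (auto intro!: add_pos_nonneg psum_nonneg)
      thus ?thesis using *[of "psum 2 ys / psum 1 ys"]
        by (simp add: field_simps power2_eq_square)
    qed simp
  qed
  have "s2\<^sup>2 \<le> s1 * s3"
    by (rule tendsto_le[OF _ tendsto_mult[OF psum_lim(1,3)] tendsto_power[OF psum_lim(2)]])
       (auto intro!: always_eventually cs pos simp del: One_nat_def)
  also have "\<dots> < s1 * (s2 / r)" using s3_less s1 by (rule mult_strict_left_mono)
  also have "\<dots> = s2\<^sup>2" by (simp add: eq power2_eq_square)
  finally show False by simp
qed

text \<open>The lower bounds come from the chains \<open>1 / r^2 \<le> s2 < s1 / r\<close> and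
  \<open>1 / r^3 \<le> s3 < s2 / r\<close>.\<close>

theorem euler_rayleigh_bounds:
  "1 < s1 * r" "1 < s2 * r\<^sup>2" "r * s2 < s1" "r * s3 < s2"
proof -
  show "r * s2 < s1" "r * s3 < s2" using s2_less s3_less r by (auto simp: field_simps)
  have l: "(1 / r) ^ 2 \<le> s2" "(1 / r) ^ 3 \<le> s3" using psum_lower psum_lim by blast+
  have "(1 / r) ^ 3 < s2 / r" using l(2) s3_less by simp
  thus a: "1 < s2 * r\<^sup>2" using r by (simp add: field_simps power2_eq_square power3_eq_cube)
  have "(1 / r) ^ 2 < s1 / r" using l(1) s2_less by simp
  thus "1 < s1 * r" using r by (simp add: field_simps power2_eq_square)
qed

end

end

text \<open>Passing to the modulus loses nothing at \<open>w = norm w\<close>, so among points of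
  equal modulus the positive one is extremal.\<close>

lemma Re_quotient_le:
  assumes "norm w < 1"
  shows "Re (w / (1 - w)) \<le> norm w / (1 - norm w)"
proof -
  have "Re (w / (1 - w)) \<le> norm (w / (1 - w))" by (rule complex_Re_le_cmod)
  also have "\<dots> = norm w / norm (1 - w)" by (simp add: norm_divide)
  also have "\<dots> \<le> norm w / (1 - norm w)"
    using assms norm_triangle_ineq2[of 1 w] by (intro divide_left_mono mult_pos_pos) auto
  finally show ?thesis .
qed

subsection \<open>Gamma quotients and convergence of power series\<close>

text \<open>The sum of \<open>norm (coeff (p N) k - b k) * R ^ k\<close> bounds the error uniformly
  on the disc and tends to 0 by Tannery's theorem.\<close>

lemma uniform_limit_power_series:
  fixes p :: "nat \<Rightarrow> complex poly" and b :: "nat \<Rightarrow> complex"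
  assumes lim: "\<And>k. (\<lambda>N. coeff (p N) k) \<longlonglongrightarrow> b k"
    and bound: "\<And>N k. norm (coeff (p N) k) \<le> M k"
    and sM: "\<And>R. R \<ge> 0 \<Longrightarrow> summable (\<lambda>k. M k * R ^ k)"
  shows "uniform_limit (cball 0 R) (\<lambda>N. poly (p N)) (\<lambda>z. \<Sum>k. b k * z ^ k) sequentially"
proof (cases "R \<ge> 0")
  case R: True
  have b: "norm (b k) \<le> M k" for k
    by (rule tendsto_upperbound[OF tendsto_norm[OF lim]]) (use bound in auto)
  define d where "d N k = norm (coeff (p N) k - b k) * R ^ k" for N k
  have d_le: "d N k \<le> 2 * (M k * R ^ k)" for N k
  proof -
    have "norm (coeff (p N) k - b k) \<le> 2 * M k"
      using norm_triangle_ineq4[of "coeff (p N) k" "b k"] bound[of N k] b[of k] by simp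
    thus ?thesis using R by (simp add: d_def mult_right_mono flip: mult.assoc)
  qed
  have d0: "d N k \<ge> 0" for N k using R by (simp add: d_def)
  have s2M: "summable (\<lambda>k. 2 * (M k * R ^ k))" using sM[OF R] by (intro summable_mult)
  have sd: "summable (d N)" for N
    by (rule summable_comparison_test'[OF s2M, of 0]) (use d_le d0 in auto)
  have "(\<lambda>N. suminf (d N)) \<longlonglongrightarrow> suminf (\<lambda>k. 0)"
  proof -
    have "(\<lambda>N. d N k) \<longlonglongrightarrow> 0" for k
    proof -
      have "(\<lambda>N. norm (coeff (p N) k - b k) * R ^ k) \<longlonglongrightarrow> norm (b k - b k) * R ^ k"
        by (intro tendsto_intros lim)
      thus ?thesis by (simp add: d_def)
    qed
    moreover have "eventually (\<lambda>(k, N). norm (d N k) \<le> 2 * (M k * R ^ k)) (sequentially \<times>\<^sub>F sequentially)"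
      using d_le d0 by (intro always_eventually) auto
    ultimately show ?thesis
      using tannerys_theorem[of "\<lambda>k N. d N k" "\<lambda>_. 0" sequentially, OF _ _ s2M sequentially_bot] by simp
  qed
  hence d_lim: "(\<lambda>N. suminf (d N)) \<longlonglongrightarrow> 0" by simp
  have est: "norm (poly (p N) z - (\<Sum>k. b k * z ^ k)) \<le> suminf (d N)" if z: "z \<in> cball 0 R" for N z
  proof -
    have zR: "norm z ^ k \<le> R ^ k" for k using z by (intro power_mono) auto
    have p: "(\<lambda>k. coeff (p N) k * z ^ k) sums poly (p N) z"
      unfolding poly_altdef by (rule sums_finite) (auto simp: coeff_eq_0)
    have "summable (\<lambda>k. b k * z ^ k)"
      by (rule summable_comparison_test'[OF sM[OF R], of 0])
         (auto simp: norm_mult norm_power intro!: mult_mono b zR order_trans[OF norm_ge_zero b])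
    hence s: "(\<lambda>k. coeff (p N) k * z ^ k - b k * z ^ k) sums (poly (p N) z - (\<Sum>k. b k * z ^ k))"
      using p by (intro sums_diff summable_sums)
    have "norm (coeff (p N) k * z ^ k - b k * z ^ k) \<le> d N k" for k
      using zR by (simp add: d_def norm_mult norm_power mult_left_mono flip: left_diff_distrib)
    hence "norm (\<Sum>k. coeff (p N) k * z ^ k - b k * z ^ k) \<le> suminf (d N)"
      using sd[of N] by (rule norm_suminf_le)
    thus ?thesis by (simp only: sums_unique[OF s, symmetric])
  qed
  show ?thesis
  proof (rule uniform_limitI)
    fix \<epsilon> :: real assume "\<epsilon> > 0"
    with d_lim have "eventually (\<lambda>N. suminf (d N) < \<epsilon>) sequentially" by (rule order_tendstoD)
    thus "\<forall>\<^sub>F N in sequentially. \<forall>z\<in>cball 0 R. dist (poly (p N) z) (\<Sum>k. b k * z ^ k) < \<epsilon>"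
    proof eventually_elim
      case (elim N)
      show ?case
      proof
        fix z :: complex assume "z \<in> cball 0 R"
        from est[OF this, of N] elim show "dist (poly (p N) z) (\<Sum>k. b k * z ^ k) < \<epsilon>"
          unfolding dist_norm by linarith
      qed
    qed
  qed
qed (auto simp: uniform_limit_iff)

section \<open>Binomial factors and Euler's approximants of Gamma\<close>

lemma esym_replicate: "esym k (replicate n c) = real (n choose k) * c ^ k"
proof (induction n arbitrary: k)
  case (Suc n)
  then show ?case by (cases k) (simp_all add: algebra_simps)
next
  case 0
  then show ?case by (cases k) simp_all
qed

lemma binomial_over_power_eq:
  assumes "n > 0"
  shows "real (n choose k) / real n ^ k = (\<Prod>i=0..<k. 1 - real i / real n) / fact k"
proof -
  have "real (n choose k) = (\<Prod>i=0..<k. real n - real i) / fact k"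
    by (simp add: binomial_gbinomial gbinomial_prod_rev)
  also have "(\<Prod>i=0..<k. real n - real i) = (\<Prod>i=0..<k. (1 - real i / real n) * real n)"
    using assms by (intro prod.cong) (auto simp: field_simps)
  also have "\<dots> = (\<Prod>i=0..<k. 1 - real i / real n) * real n ^ k"
    by (simp add: prod.distrib)
  finally show ?thesis using assms by simp
qed

lemma binomial_over_power_le:
  assumes "n > 0"
  shows "real (n choose k) / real n ^ k \<le> 1 / fact k"
proof (cases "k \<le> n")
  case True
  have "(\<Prod>i=0..<k. 1 - real i / real n) \<le> 1"
    using True assms by (intro prod_le_1) (auto simp: field_simps)
  thus ?thesis unfolding binomial_over_power_eq[OF assms] by (intro divide_right_mono) auto
qed (simp add: binomial_eq_0)

lemma binomial_over_power_lim:
  "(\<lambda>N. real (Suc N choose k) / real (Suc N) ^ k) \<longlonglongrightarrow> 1 / fact k"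
proof -
  have "(\<lambda>N. (\<Prod>i=0..<k. 1 - real i * (1 / real (Suc N))) / fact k) \<longlonglongrightarrow> (\<Prod>i=0..<k. 1 - real i * 0) / fact k"
    using LIMSEQ_Suc[OF lim_1_over_n] by (intro tendsto_intros) auto
  thus ?thesis using binomial_over_power_eq[of "Suc _" k] by simp
qed

text \<open>\<open>harm n - ln n\<close> decreases from its value 1 at \<open>n = 1\<close>.\<close>

lemma harm_le_ln: "n > 0 \<Longrightarrow> harm n \<le> 1 + ln (real n)"
  using decseqD[OF decseq_harm_diff_ln, of 0 "n - 1"] by (simp add: harm_def)

lemma prod_list_map_upt: "(\<Prod>j\<leftarrow>[0..<n]. f j) = (\<Prod>j<n. f j)"
  by (simp add: prod.distinct_set_conv_list atLeast0LessThan[symmetric] flip: set_upt)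

lemma Gamma_series_nonneg: "s > 0 \<Longrightarrow> Gamma_series s n \<ge> (0 :: real)"
  unfolding Gamma_series_def
  by (intro divide_nonneg_nonneg mult_nonneg_nonneg less_imp_le[OF pochhammer_pos]) auto

text \<open>The factorials cancel in the quotient of Euler's approximants, and the Pochhammer
  products leave exactly the factors produced by \<open>euler_op\<close>.\<close>

lemma Gamma_series_ratio_eq:
  fixes \<beta> s :: real
  assumes "\<beta> > 0" "s \<ge> 0" "n > 0"
  shows "Gamma_series \<beta> n / Gamma_series (s + \<beta>) n =
           (\<Prod>j<Suc n. 1 + s / (\<beta> + real j)) * real n powr (- s)"
proof -
  have "(\<Prod>j<Suc n. 1 + s / (\<beta> + real j)) = (\<Prod>j<Suc n. (s + \<beta> + real j) / (\<beta> + real j))"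
    using assms by (intro prod.cong refl) (simp add: field_simps add_pos_nonneg)
  also have "\<dots> = pochhammer (s + \<beta>) (Suc n) / pochhammer \<beta> (Suc n)"
    by (simp only: prod_dividef pochhammer_prod atLeast0LessThan)
  finally have 1: "(\<Prod>j<Suc n. 1 + s / (\<beta> + real j)) = pochhammer (s + \<beta>) (Suc n) / pochhammer \<beta> (Suc n)" .
  have nz: "pochhammer (s + \<beta>) (Suc n) \<noteq> 0" "pochhammer \<beta> (Suc n) \<noteq> 0"
    using assms by (auto intro!: less_imp_neq[THEN not_sym] pochhammer_pos)
  have quot: "(f * b / p) / (f * (a * b) / q) = q / p * inverse a"
    if "f \<noteq> 0" "a \<noteq> 0" "b \<noteq> 0" "p \<noteq> 0" "q \<noteq> 0" for f a b p q :: real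
    using that by (simp add: field_simps)
  have "exp ((s + \<beta>) * ln (real n)) = exp (s * ln (real n)) * exp (\<beta> * ln (real n))"
    by (simp only: exp_add distrib_right)
  moreover have "real n powr (- s) = inverse (exp (s * ln (real n)))"
    using assms(3) by (simp add: powr_def exp_minus)
  ultimately show ?thesis
    unfolding 1 Gamma_series_def of_real_eq_id id_apply Suc_eq_plus1[symmetric]
    by (simp only:) (rule quot, use nz in auto)
qed

text \<open>A bound independent of \<open>n\<close>, as a majorant requires: the product is at most
  the exponential of a harmonic sum, whose logarithmic growth cancels
  \<open>n powr (- s)\<close>.\<close>

lemma Gamma_series_ratio_le:
  fixes \<beta> s :: real
  assumes "\<beta> > 0" "s \<ge> 0" "n > 0"
  shows "Gamma_series \<beta> n / Gamma_series (s + \<beta>) n \<le> exp (s * (1 / \<beta> + 1))"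
proof -
  have "(\<Prod>j<Suc n. 1 + s / (\<beta> + real j)) \<le> (\<Prod>j<Suc n. exp (s / (\<beta> + real j)))"
    using assms by (intro prod_mono) (auto intro!: add_nonneg_nonneg)
  also have "\<dots> = exp (\<Sum>j<Suc n. s / (\<beta> + real j))" by (rule exp_sum[symmetric]) simp
  \<comment> \<open>The term \<open>j = 0\<close> is kept apart, since \<open>s / \<beta>\<close>
    may be large; every later one is at most \<open>s / j\<close>.\<close>
  also have "(\<Sum>j<Suc n. s / (\<beta> + real j)) = s / \<beta> + (\<Sum>j<n. s / (\<beta> + real (Suc j)))"
    by (subst sum.lessThan_Suc_shift) simp
  also have "(\<Sum>j<n. s / (\<beta> + real (Suc j))) \<le> (\<Sum>j<n. s * inverse (real (Suc j)))"
    using assms by (intro sum_mono) (auto simp: field_simps intro!: mult_left_mono)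
  also have "\<dots> = s * harm n"
    unfolding harm_def sum_distrib_left[symmetric]
    by (intro arg_cong[of _ _ "(*) s"] sum.reindex_bij_witness[of _ "\<lambda>i. i - 1" Suc]) auto
  also have "s * harm n \<le> s * (1 + ln (real n))" using harm_le_ln assms by (intro mult_left_mono) auto
  finally have "(\<Prod>j<Suc n. 1 + s / (\<beta> + real j)) \<le> exp (s / \<beta> + s * (1 + ln (real n)))" by simp
  also have "\<dots> = exp (s * (1 / \<beta> + 1)) * real n powr s"
    using assms by (simp add: powr_def exp_add[symmetric] algebra_simps)
  finally have "(\<Prod>j<Suc n. 1 + s / (\<beta> + real j)) * real n powr (- s)
      \<le> exp (s * (1 / \<beta> + 1)) * real n powr s * real n powr (- s)" by (intro mult_right_mono) auto
  also have "\<dots> = exp (s * (1 / \<beta> + 1))" using assms by (simp add: powr_minus)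
  finally show ?thesis unfolding Gamma_series_ratio_eq[OF assms] .
qed

text \<open>Log-convexity of \<open>\<Gamma>\<close> at the points \<open>x - 1 < x < x + s\<close>.\<close>

lemma Gamma_quotient_le:
  fixes x s :: real
  assumes "x > 1" "s > 0"
  shows "Gamma x / Gamma (x + s) \<le> (x - 1) powr (- s)"
proof -
  have G: "Gamma (x - 1) > 0" "Gamma x > 0" "Gamma (x + s) > 0"
    using assms by (auto intro!: Gamma_real_pos)
  have "Gamma x = (x - 1) * Gamma (x - 1)"
    using Gamma_plus1[of "x - 1"] nonpos_Ints_nonpos[of "x - 1"] assms by auto
  hence ln1: "ln (Gamma (x - 1)) = ln (Gamma x) - ln (x - 1)"
    using ln_mult_pos[of "x - 1" "Gamma (x - 1)"] G(1) assms(1) by simp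
  \<comment> \<open>The weight that makes \<open>x\<close> the convex combination of
    \<open>x - 1\<close> and \<open>x + s\<close>.\<close>
  define t where "t = 1 / (1 + s)"
  have t: "0 \<le> t" "t \<le> 1" "t * (1 + s) = 1" using assms by (auto simp: t_def field_simps)
  have x_eq: "(1 - t) * (x - 1) + t * (x + s) = x"
    using t(3) by (simp add: algebra_simps)
  have "(ln \<circ> Gamma) ((1 - t) *\<^sub>R (x - 1) + t *\<^sub>R (x + s)) \<le>
          (1 - t) * (ln \<circ> Gamma) (x - 1) + t * (ln \<circ> Gamma) (x + s)"
    by (rule convex_onD[OF log_convex_Gamma_real]) (use assms t in auto)
  hence "ln (Gamma x) \<le> (1 - t) * (ln (Gamma x) - ln (x - 1)) + t * ln (Gamma (x + s))"
    using x_eq by (simp add: ln1)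
  hence "(1 + s) * ln (Gamma x) \<le> (1 + s) * ((1 - t) * (ln (Gamma x) - ln (x - 1)) + t * ln (Gamma (x + s)))"
    using assms by (intro mult_left_mono) auto
  also have "\<dots> = ((1 + s) - t * (1 + s)) * (ln (Gamma x) - ln (x - 1)) + (t * (1 + s)) * ln (Gamma (x + s))"
    by (simp add: algebra_simps)
  finally have "ln (Gamma x) - ln (Gamma (x + s)) \<le> - s * ln (x - 1)"
    unfolding t(3) by (simp add: algebra_simps)
  hence "exp (ln (Gamma x / Gamma (x + s))) \<le> exp (- s * ln (x - 1))"
    using G by (subst exp_le_cancel_iff) (simp add: ln_div)
  thus ?thesis using G assms by (simp add: powr_def)
qed

subsection \<open>The Wright function\<close>

locale wright =
  fixes \<rho> \<beta> :: real
  assumes rho: "\<rho> > 0" and beta: "\<beta> > 0"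
begin

text \<open>Unsigned coefficients. Each passage from \<open>p\<close> to \<open>(z p)'\<close>
  contributes a factor \<open>k + 1\<close>, so that \<open>F 0\<close>, \<open>F 1\<close>,
  \<open>F 2\<close> below are h / z, h' and (z h')'.\<close>

definition U :: "nat \<Rightarrow> nat \<Rightarrow> real" where
  "U m k = real (k + 1) ^ m * Gamma \<beta> / (fact k * Gamma (real k * \<rho> + \<beta>))"

definition A :: "nat \<Rightarrow> complex fps" where
  "A m = Abs_fps (\<lambda>k. of_real ((-1) ^ k * U m k))"

definition F :: "nat \<Rightarrow> complex \<Rightarrow> complex" where
  "F m = eval_fps (A m)"

lemma Gamma_pos: "Gamma (real k * \<rho> + \<beta>) > 0" "Gamma \<beta> > 0"
  using rho beta by (auto intro!: Gamma_real_pos add_nonneg_pos)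

lemma U_Suc: "U (Suc m) k = real (k + 1) * U m k"
  by (simp add: U_def)

lemma U_pos: "U m k > 0"
  unfolding U_def using Gamma_pos by (intro divide_pos_pos mult_pos_pos) auto

text \<open>The factors \<open>1 + k \<rho> / (\<beta> + j)\<close> that the operators contribute to the \<open>k\<close>-th coefficient and the
  power of \<open>Suc N\<close> in the initial root make up the \<open>(N + 1)\<close>-st Euler approximation of
  \<open>\<Gamma>(\<beta>) / \<Gamma>(k \<rho> + \<beta>)\<close>.\<close>

definition Q :: "nat \<Rightarrow> nat \<Rightarrow> complex poly" where
  "Q m N = foldr (\<lambda>a. euler_op (of_real a))
     (replicate m 1 @ map (\<lambda>j. \<rho> / (\<beta> + real j)) [0..<Suc (Suc N)])
     (root_poly (replicate (Suc N) (1 / real (Suc N) * real (Suc N) powr (- \<rho>))))"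

lemma Q_Suc: "Q (Suc m) N = euler_op 1 (Q m N)"
  by (simp add: Q_def)

definition V :: "nat \<Rightarrow> nat \<Rightarrow> nat \<Rightarrow> real" where
  "V m N k = real (k + 1) ^ m * (real (Suc N choose k) / real (Suc N) ^ k) *
     (Gamma_series \<beta> (Suc N) / Gamma_series (real k * \<rho> + \<beta>) (Suc N))"

lemma coeff_Q: "coeff (Q m N) k = of_real ((-1) ^ k * V m N k)"
proof -
  \<comment> \<open>The degree \<open>Suc N\<close> avoids division by 0. Euler's approximant of
    index \<open>n\<close> has \<open>n + 1\<close> factors, hence \<open>Suc n\<close> operators
    besides the \<open>m\<close> copies with parameter 1.\<close>
  define n where "n = Suc N"
  have "coeff (Q m N) k = of_real ((1 + real k) ^ m * (\<Prod>j<Suc n. 1 + real k * \<rho> / (\<beta> + real j)) *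
          ((-1) ^ k * (real (n choose k) * (1 / real n * real n powr (- \<rho>)) ^ k)))"
    unfolding Q_def coeff_foldr_euler_op coeff_root_poly esym_replicate n_def[symmetric]
    by (simp add: prod_list_map_upt o_def mult_ac prod_list_replicate del: upt_Suc)
  also have "(1 / real n * real n powr (- \<rho>)) ^ k = real n powr (- (real k * \<rho>)) / real n ^ k"
    by (simp add: n_def power_mult_distrib powr_power power_one_over field_simps)
  finally have "coeff (Q m N) k = of_real ((1 + real k) ^ m * (\<Prod>j<Suc n. 1 + real k * \<rho> / (\<beta> + real j)) *
          ((-1) ^ k * (real (n choose k) * (real n powr (- (real k * \<rho>)) / real n ^ k))))" .
  moreover have "V m N k = real (k + 1) ^ m * (real (n choose k) / real n ^ k) *
      ((\<Prod>j<Suc n. 1 + real k * \<rho> / (\<beta> + real j)) * real n powr (- (real k * \<rho>)))"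
    unfolding V_def n_def[symmetric] using rho beta
    by (subst Gamma_series_ratio_eq) (auto simp: n_def)
  ultimately show ?thesis by (simp add: add_ac mult_ac del: prod.lessThan_Suc)
qed

lemma Q_roots: "\<exists>ys. (\<forall>y\<in>set ys. y > 0) \<and> Q m N = root_poly ys"
  unfolding Q_def using rho beta
  by (intro foldr_euler_op_root_poly) (auto intro!: divide_pos_pos add_pos_nonneg)

definition X :: "nat \<Rightarrow> nat \<Rightarrow> real list" where
  "X m N = (SOME ys. (\<forall>y\<in>set ys. y > 0) \<and> Q m N = root_poly ys)"

lemma X: "\<forall>y\<in>set (X m N). y > 0" "root_poly (X m N) = Q m N"
  using someI_ex[OF Q_roots[of m N]] by (auto simp: X_def)

text \<open>A majorant of \<open>V m N k\<close> for all \<open>N\<close> at once.\<close>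

definition M :: "nat \<Rightarrow> nat \<Rightarrow> real" where
  "M m k = real (k + 1) ^ m * (1 / fact k) * exp (\<rho> * (1 / \<beta> + 1)) ^ k"

lemma Gamma_series_ratio_nonneg:
  "Gamma_series \<beta> n / Gamma_series (real k * \<rho> + \<beta>) n \<ge> 0"
  using rho beta by (intro divide_nonneg_nonneg Gamma_series_nonneg add_nonneg_pos) auto

lemma V_nonneg: "V m N k \<ge> 0"
  unfolding V_def by (intro mult_nonneg_nonneg Gamma_series_ratio_nonneg) auto

lemma V_le: "V m N k \<le> M m k"
proof -
  have "Gamma_series \<beta> (Suc N) / Gamma_series (real k * \<rho> + \<beta>) (Suc N) \<le> exp (\<rho> * (1 / \<beta> + 1)) ^ k"
    using Gamma_series_ratio_le[of \<beta> "real k * \<rho>" "Suc N"] rho beta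
    by (simp add: mult.assoc flip: exp_of_nat_mult)
  thus ?thesis unfolding V_def M_def
    using binomial_over_power_le[of "Suc N" k] Gamma_series_ratio_nonneg[of "Suc N" k]
    by (intro mult_mono) auto
qed

lemma V_lim: "(\<lambda>N. V m N k) \<longlonglongrightarrow> U m k"
proof -
  have "(\<lambda>N. V m N k) \<longlonglongrightarrow> real (k + 1) ^ m * (1 / fact k) * (Gamma \<beta> / Gamma (real k * \<rho> + \<beta>))"
    unfolding V_def using Gamma_pos(1)[of k]
    by (intro tendsto_intros binomial_over_power_lim LIMSEQ_Suc[OF Gamma_series_LIMSEQ]) auto
  thus ?thesis by (simp add: U_def)
qed

text \<open>\<open>(k + 1) ^ m \<le> exp (m * (k + 1))\<close> is geometric in \<open>k\<close>, so
  an exponential series still dominates.\<close>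

lemma summable_M:
  assumes "R \<ge> 0"
  shows "summable (\<lambda>k. M m k * R ^ k)"
proof -
  define c where "c = exp (\<rho> * (1 / \<beta> + 1)) * R"
  have c: "c \<ge> 0" using assms by (simp add: c_def)
  have "summable (\<lambda>k. (exp (real m) * c) ^ k /\<^sub>R fact k * exp (real m))"
    by (intro summable_mult2 summable_exp_generic)
  moreover have "norm (M m k * R ^ k) \<le> (exp (real m) * c) ^ k /\<^sub>R fact k * exp (real m)" for k
  proof -
    have "real (k + 1) \<le> exp (real k + 1)" using exp_ge_add_one_self[of "real k + 1"] by linarith
    hence "real (k + 1) ^ m \<le> exp (real k + 1) ^ m" by (intro power_mono) auto
    also have "\<dots> = exp (real m) ^ k * exp (real m)"
      by (simp add: exp_add[symmetric] algebra_simps flip: exp_of_nat_mult)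
    finally have "real (k + 1) ^ m * (c ^ k / fact k) \<le> exp (real m) ^ k * exp (real m) * (c ^ k / fact k)"
      using c by (intro mult_right_mono) auto
    moreover have "M m k * R ^ k = real (k + 1) ^ m * (c ^ k / fact k)"
      by (simp add: M_def c_def power_mult_distrib)
    moreover have "real (k + 1) ^ m * (c ^ k / fact k) \<ge> 0" using c by simp
    ultimately show ?thesis by (simp add: power_mult_distrib field_simps)
  qed
  ultimately show ?thesis by (rule summable_comparison_test'[where N = 0])
qed

lemma U_le: "U m k \<le> M m k"
  by (rule tendsto_upperbound[OF V_lim]) (auto simp: V_le)

lemma conv_radius_A [simp]: "fps_conv_radius (A m) = \<infinity>"
  unfolding fps_conv_radius_def
proof (rule conv_radius_inftyI')
  fix r :: real assume r: "r > 0"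
  have "summable (\<lambda>k. fps_nth (A m) k * of_real r ^ k)"
    by (rule summable_comparison_test'[OF summable_M[of r m], of 0])
       (use r U_pos[of m] U_le[of m] in \<open>auto simp: A_def norm_mult norm_power abs_mult less_imp_le\<close>)
  thus "\<exists>z. norm z = r \<and> summable (\<lambda>n. fps_nth (A m) n * z ^ n)"
    using r by (intro exI[of _ "of_real r"]) auto
qed

lemma root_poly_limit: "root_poly_limit (X m) (F m) (U m)"
proof
  show "x > 0" if "x \<in> set (X m N)" for N x using that X by blast
  have nc: "norm (coeff (Q m N) k) \<le> M m k" for N k
    unfolding coeff_Q norm_of_real using V_nonneg[of m N k] V_le[of m N k] by (simp add: abs_mult)
  have lim: "(\<lambda>N. coeff (Q m N) k) \<longlonglongrightarrow> fps_nth (A m) k" for k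
    unfolding coeff_Q A_def fps_nth_Abs_fps by (intro tendsto_intros V_lim)
  show "uniform_limit (cball 0 R) (\<lambda>N. poly (root_poly (X m N))) (F m) sequentially" for R
    using uniform_limit_power_series[OF lim nc summable_M] by (simp add: X F_def eval_fps_def[abs_def])
  show "(\<lambda>N. esym k (X m N)) \<longlonglongrightarrow> U m k" for k
  proof -
    have "of_real ((-1) ^ k * esym k (X m N)) = (of_real ((-1) ^ k * V m N k) :: complex)" for N
      using coeff_root_poly[of "X m N" k] coeff_Q[of m N k] by (simp add: X)
    hence "esym k (X m N) = V m N k" for N by (simp only: of_real_eq_iff) simp
    thus ?thesis using V_lim by simp
  qed
qed

text \<open>The factor \<open>k + 1\<close> cancels against the factorials; of the rest, the Gamma
  quotient tends to 0 by \<open>Gamma_quotient_le\<close> and the powers tend to 1.\<close>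

lemma U_ratio: "(\<lambda>k. real (k + 1) * U m (k + 1) / U m k) \<longlonglongrightarrow> 0"
proof -
  have lim: "filterlim (\<lambda>k. real k * \<rho> + \<beta> - 1) at_top sequentially"
    using rho by real_asymp
  have "(\<lambda>k. Gamma (real k * \<rho> + \<beta>) / Gamma (real (k + 1) * \<rho> + \<beta>)) \<longlonglongrightarrow> 0"
  proof (rule Lim_null_comparison)
    from lim have "eventually (\<lambda>k. real k * \<rho> + \<beta> - 1 > 0) sequentially"
      unfolding filterlim_at_top_dense by blast
    thus "eventually (\<lambda>k. norm (Gamma (real k * \<rho> + \<beta>) / Gamma (real (k + 1) * \<rho> + \<beta>))
            \<le> (real k * \<rho> + \<beta> - 1) powr (- \<rho>)) sequentially"
    proof eventually_elim
      case (elim k)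
      then show ?case using Gamma_quotient_le[of "real k * \<rho> + \<beta>" \<rho>] rho Gamma_pos(1)[of k] Gamma_pos(1)[of "k + 1"]
        by (simp add: algebra_simps)
    qed
    show "(\<lambda>k. (real k * \<rho> + \<beta> - 1) powr (- \<rho>)) \<longlonglongrightarrow> 0"
      using rho by (intro tendsto_neg_powr lim) auto
  qed
  moreover have "(\<lambda>k. ((real k + 2) / (real k + 1)) ^ m) \<longlonglongrightarrow> 1 ^ m"
    by (intro tendsto_power) real_asymp
  ultimately have "(\<lambda>k. ((real k + 2) / (real k + 1)) ^ m * (Gamma (real k * \<rho> + \<beta>) / Gamma (real (k + 1) * \<rho> + \<beta>)))
      \<longlonglongrightarrow> 1 ^ m * 0" by (intro tendsto_mult)
  moreover have "real (k + 1) * U m (k + 1) / U m k =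
      ((real k + 2) / (real k + 1)) ^ m * (Gamma (real k * \<rho> + \<beta>) / Gamma (real (k + 1) * \<rho> + \<beta>))" for k
    using Gamma_pos(2) by (simp add: U_def power_divide add_ac)
  ultimately show ?thesis by simp
qed

lemma root_poly_limit_fast: "root_poly_limit_fast (X m) (F m) (U m)"
  using root_poly_limit by (rule root_poly_limit_fast.intro)
    (unfold_locales, rule U_pos, rule U_ratio)

section \<open>Derivatives and identification with h\<close>

lemma has_field_derivative_F: "((\<lambda>z. z * F m z) has_field_derivative F (Suc m) z) (at z)"
proof -
  have "fps_deriv (fps_X * A m) = A (Suc m)"
    by (rule fps_ext) (simp add: A_def U_Suc algebra_simps)
  moreover have r: "fps_conv_radius (fps_X * A m) = \<infinity>"
    using fps_conv_radius_mult[of fps_X "A m"] by simp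
  ultimately have "(eval_fps (fps_X * A m) has_field_derivative eval_fps (A (Suc m)) z) (at z)"
    using has_field_derivative_eval_fps[of z "fps_X * A m"] by simp
  moreover have "eval_fps (fps_X * A m) = (\<lambda>z. z * F m z)"
    by (rule ext, subst eval_fps_mult) (auto simp: F_def)
  ultimately show ?thesis by (simp add: F_def)
qed

lemma wright_h_eq: "wright_h \<rho> \<beta> z = z * F 0 z"
proof -
  define t where "t n = (- z) ^ n / (fact n * of_real (Gamma (of_nat n * \<rho> + \<beta>)))" for n
  have eq: "fps_nth (A 0) n * z ^ n = of_real (Gamma \<beta>) * t n" for n
    by (simp add: A_def U_def t_def power_minus[of z] field_simps)
  have "summable (\<lambda>n. fps_nth (A 0) n * z ^ n)" by (rule summable_fps) simp
  hence "summable (\<lambda>n. of_real (Gamma \<beta>) * t n)" unfolding eq .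
  hence "summable t" using Gamma_pos(2) by (subst (asm) summable_cmult_iff) auto
  hence "F 0 z = of_real (Gamma \<beta>) * suminf t"
    unfolding F_def eval_fps_def eq by (rule suminf_mult)
  thus ?thesis by (simp add: wright_h_def wright_phi_def t_def[abs_def] mult.assoc)
qed

lemma deriv_wright_h: "deriv (wright_h \<rho> \<beta>) = F 1"
proof
  fix z
  have "wright_h \<rho> \<beta> = (\<lambda>z. z * F 0 z)" using wright_h_eq by blast
  thus "deriv (wright_h \<rho> \<beta>) z = F 1 z"
    using has_field_derivative_F[of 0 z] by (simp add: DERIV_imp_deriv)
qed

section \<open>The quotient (z h')' / h' and the radius of convexity\<close>

sublocale f: root_poly_limit "X 1" "F 1" "U 1" by (rule root_poly_limit)
sublocale g: root_poly_limit_fast "X 2" "F 2" "U 2" by (rule root_poly_limit_fast)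

lemma deriv_g: "deriv (\<lambda>z. z * F 1 z) = F 2"
  using has_field_derivative_F[of 1] by (auto simp: DERIV_imp_deriv numeral_2_eq_2)

lemma F_2_eq: "F 2 z = F 1 z + z * deriv (F 1) z"
proof -
  have "F 1 field_differentiable at z"
    using f.holomorphic[of UNIV] by (simp add: holomorphic_on_def)
  hence "(F 1 has_field_derivative deriv (F 1) z) (at z)" by (rule field_differentiable_derivI)
  hence "((\<lambda>z. z * F 1 z) has_field_derivative F 1 z + z * deriv (F 1) z) (at z)"
    by (auto intro!: derivative_eq_intros)
  thus ?thesis using has_field_derivative_F[of 1 z] DERIV_unique by (fastforce simp: numeral_2_eq_2)
qed

text \<open>Rolle's theorem for \<open>t * F 1 t\<close>, which vanishes at 0 and would vanish at a
  zero of \<open>F 1\<close>: its derivative \<open>F 2\<close> would have an earlier zero.\<close>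

lemma F_1_nonzero:
  assumes "\<And>t. 0 < t \<Longrightarrow> t < r \<Longrightarrow> F 2 (of_real t) \<noteq> 0" "0 < t" "t < r"
  shows "F 1 (of_real t) \<noteq> 0"
proof
  assume zero: "F 1 (of_real t) = 0"
  define \<phi> where "\<phi> t = Re (of_real t * F 1 (of_real t))" for t
  have deriv: "(\<phi> has_real_derivative Re (F 2 (of_real s))) (at s)" for s
  proof -
    have "((\<lambda>t. of_real t * F 1 (of_real t)) has_vector_derivative F 2 (of_real s)) (at s)"
      using has_vector_derivative_real_field[OF has_field_derivative_F[of 1 "of_real s"]]
      by (simp add: numeral_2_eq_2)
    from bounded_linear.has_vector_derivative[OF bounded_linear_Re this] show ?thesis
      by (simp add: \<phi>_def[abs_def] has_real_derivative_iff_has_vector_derivative)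
  qed
  have "\<exists>s>0. s < t \<and> DERIV \<phi> s :> 0"
  proof (rule Rolle[OF assms(2)])
    show "\<phi> 0 = \<phi> t" using zero by (simp add: \<phi>_def)
    show "continuous_on {0..t} \<phi>"
      using deriv DERIV_isCont by (auto intro!: continuous_at_imp_continuous_on)
    show "\<phi> differentiable (at s)" for s using deriv real_differentiable_def by blast
  qed
  then obtain s where s: "0 < s" "s < t" "DERIV \<phi> s :> 0" by blast
  hence "Re (F 2 (of_real s)) = 0" using deriv DERIV_unique by blast
  hence "F 2 (of_real s) = 0" using g.F_of_real[of s]
    by (simp add: complex_eq_iff complex_is_Real_iff)
  thus False using assms s by auto
qed

text \<open>By the hypothesis on the axis, eventually \<open>x * norm z < 1\<close> for all inverse
  roots \<open>x\<close>, so \<open>Re_quotient_le\<close> compares the sums for the approximants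
  term by term.\<close>

lemma F_quotient_ge:
  assumes "\<And>t. 0 < t \<Longrightarrow> t \<le> norm z \<Longrightarrow> F 1 (of_real t) \<noteq> 0" "z \<noteq> 0" "F 1 z \<noteq> 0"
  shows "Re (F 2 z / F 1 z) \<ge> Re (F 2 (of_real (norm z)) / F 1 (of_real (norm z)))"
proof -
  have z: "norm z > 0" using assms by simp
  have lim: "(\<lambda>N. Re (poly (Q 2 N) w / poly (Q 1 N) w)) \<longlonglongrightarrow> Re (F 2 w / F 1 w)" if "F 1 w \<noteq> 0" for w
    using f.pointwise[of w] g.pointwise[of w] that by (intro tendsto_intros) (auto simp: X)
  have "eventually (\<lambda>N. \<forall>x\<in>set (X 1 N). x < 1 / norm z) sequentially"
    using z by (rule f.eventually_roots_less) (rule assms)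
  hence "eventually (\<lambda>N. Re (poly (Q 2 N) (of_real (norm z)) / poly (Q 1 N) (of_real (norm z)))
           \<le> Re (poly (Q 2 N) z / poly (Q 1 N) z)) sequentially"
  proof eventually_elim
    case (elim N)
    define xs where "xs = X 1 N"
    have xs: "0 < x \<and> x * norm z < 1" if "x \<in> set xs" for x
      using that elim X(1)[of 1 N] z by (auto simp: xs_def field_simps)
    have q: "poly (Q 2 N) w / poly (Q 1 N) w = 1 - (\<Sum>x\<leftarrow>xs. of_real x * w / (1 - of_real x * w))"
      if w: "norm w = norm z" for w
    proof -
      have "poly (root_poly xs) w \<noteq> 0"
      proof
        assume "poly (root_poly xs) w = 0"
        then obtain x where x: "x \<in> set xs" "of_real x * w = 1" by (auto simp: poly_root_poly_eq_0_iff)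
        hence "norm (of_real x * w) = 1" by simp
        thus False using xs[OF x(1)] w by (simp add: norm_mult)
      qed
      from euler_op_root_poly_quotient[OF this, of 1] show ?thesis
        using Q_Suc[of 1 N] by (simp add: xs_def X numeral_2_eq_2)
    qed
    have "Re (\<Sum>x\<leftarrow>ys. of_real x * z / (1 - of_real x * z)) \<le>
          Re (\<Sum>x\<leftarrow>ys. of_real x * of_real (norm z) / (1 - of_real x * of_real (norm z)))"
      if "set ys \<subseteq> set xs" for ys using that
    proof (induction ys)
      case (Cons y ys)
      have y: "0 < y" "y * norm z < 1" using xs Cons.prems by auto
      have "Re (of_real y * z / (1 - of_real y * z)) \<le> y * norm z / (1 - y * norm z)"
        using Re_quotient_le[of "of_real y * z"] y by (simp add: norm_mult)
      also have "\<dots> = Re (of_real y * of_real (norm z) / (1 - of_real y * of_real (norm z)))"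
      proof -
        have "of_real y * of_real (norm z) / (1 - of_real y * of_real (norm z)) =
                complex_of_real (y * norm z / (1 - y * norm z))" by simp
        thus ?thesis by (simp only: Re_complex_of_real)
      qed
      finally show ?case using Cons by simp
    qed simp
    note sum_le = this[of xs, OF order_refl]
    have norm_z: "norm (complex_of_real (norm z)) = norm z" by simp
    from sum_le show ?case unfolding q[OF refl] q[OF norm_z] by simp
  qed
  moreover have "F 1 (of_real (norm z)) \<noteq> 0" using assms z by blast
  ultimately show ?thesis using assms(3) by (intro tendsto_le[OF _ lim lim]) auto
qed

text \<open>Below \<open>r\<close> the quotient \<open>F 2 / F 1\<close> is positive on the axis,
  hence by \<open>F_quotient_ge\<close> has positive real part on the disc; at \<open>r\<close> its
  numerator is 0, so no larger disc qualifies.\<close>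

lemma radius_of_convexity_eq:
  assumes r: "r > 0" "F 2 (of_real r) = 0" "\<And>t. 0 < t \<Longrightarrow> t < r \<Longrightarrow> F 2 (of_real t) \<noteq> 0"
  shows "radius_of_convexity (wright_h \<rho> \<beta>) = ereal r"
proof -
  have hol: "wright_h \<rho> \<beta> holomorphic_on B" for B
  proof -
    have "wright_h \<rho> \<beta> = (\<lambda>z. z * F 0 z)" using wright_h_eq by blast
    thus ?thesis
      using has_field_derivative_F[of 0] by (metis field_differentiable_at_within field_differentiable_def holomorphic_onI)
  qed
  have quot: "1 + z * deriv (F 1) z / F 1 z = F 2 z / F 1 z" if "F 1 z \<noteq> 0" for z
    using that by (simp add: F_2_eq field_simps)
  have inner: "F 1 z \<noteq> 0 \<and> Re (1 + z * deriv (F 1) z / F 1 z) > 0" if z: "norm z < r" for z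
  proof (cases "z = 0")
    case False
    hence z0: "norm z > 0" by simp
    have nz1: "F 1 (of_real t) \<noteq> 0" if "0 < t" "t \<le> norm z" for t
      using F_1_nonzero[OF r(3)] that z by simp
    have nz2: "F 2 (of_real t) \<noteq> 0" if "0 < t" "t \<le> norm z" for t
      using r(3) that z by simp
    define w where "w = complex_of_real (norm z)"
    have w1: "Re (F 1 w) > 0" "F 1 w = of_real (Re (F 1 w))"
    proof -
      show eq: "F 1 w = of_real (Re (F 1 w))" using f.F_of_real[of "norm z"] by (simp add: w_def)
      have "F 1 w \<noteq> 0" using nz1 z0 by (simp add: w_def)
      hence "Re (F 1 w) \<noteq> 0" using eq by (metis of_real_0)
      moreover have "Re (F 1 w) \<ge> 0" unfolding w_def by (rule f.norm_F_ge) (rule nz1)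
      ultimately show "Re (F 1 w) > 0" by simp
    qed
    have w2: "Re (F 2 w) > 0" "F 2 w = of_real (Re (F 2 w))"
    proof -
      show eq: "F 2 w = of_real (Re (F 2 w))" using g.F_of_real[of "norm z"] by (simp add: w_def)
      have "F 2 w \<noteq> 0" using nz2 z0 by (simp add: w_def)
      hence "Re (F 2 w) \<noteq> 0" using eq by (metis of_real_0)
      moreover have "Re (F 2 w) \<ge> 0" unfolding w_def by (rule g.norm_F_ge) (rule nz2)
      ultimately show "Re (F 2 w) > 0" by simp
    qed
    \<comment> \<open>Off the axis \<open>F 1\<close> cannot vanish, as its modulus is at least its
      positive value at \<open>norm z\<close>.\<close>
    have "norm (F 1 z) \<ge> Re (F 1 w)" unfolding w_def by (rule f.norm_F_ge) (rule nz1)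
    hence F1: "F 1 z \<noteq> 0" using w1 by auto
    have "F 2 w / F 1 w = of_real (Re (F 2 w) / Re (F 1 w))" using w1 w2 by (metis of_real_divide)
    hence "Re (F 2 w / F 1 w) = Re (F 2 w) / Re (F 1 w)" by (metis Re_complex_of_real)
    hence "0 < Re (F 2 w / F 1 w)" using w1(1) w2(1) by simp
    also have "\<dots> \<le> Re (F 2 z / F 1 z)" unfolding w_def
      by (rule F_quotient_ge) (use nz1 F1 False in auto)
    finally show ?thesis using F1 quot by simp
  qed (use f.F_0 in simp)
  show ?thesis unfolding radius_of_convexity_def deriv_wright_h
  proof (rule Sup_eqI)
    fix y assume "y \<in> ereal ` {r. r > 0 \<and> wright_h \<rho> \<beta> holomorphic_on ball 0 r \<and>
       (\<forall>z\<in>ball 0 r. F 1 z \<noteq> 0 \<and> Re (1 + z * deriv (F 1) z / F 1 z) > 0)}"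
    then obtain s where s: "y = ereal s" "s > 0"
      "\<And>z. z \<in> ball 0 s \<Longrightarrow> F 1 z \<noteq> 0 \<and> Re (1 + z * deriv (F 1) z / F 1 z) > 0" by auto
    have "s \<le> r"
    proof (rule ccontr)
      assume "\<not> s \<le> r"
      hence "of_real r \<in> ball (0::complex) s" using r by simp
      from s(3)[OF this] have nz: "F 1 (of_real r) \<noteq> 0"
        and gt: "Re (1 + of_real r * deriv (F 1) (of_real r) / F 1 (of_real r)) > 0" by blast+
      show False using gt unfolding quot[OF nz] r(2) by simp
    qed
    thus "y \<le> ereal r" using s by simp
  next
    fix y assume y: "\<And>z. z \<in> ereal ` {r. r > 0 \<and> wright_h \<rho> \<beta> holomorphic_on ball 0 r \<and>
       (\<forall>z\<in>ball 0 r. F 1 z \<noteq> 0 \<and> Re (1 + z * deriv (F 1) z / F 1 z) > 0)} \<Longrightarrow> z \<le> y"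
    show "ereal r \<le> y" by (rule y, rule imageI) (use r hol inner in auto)
  qed
qed

end

section \<open>Explicit bounds in terms of Gamma values\<close>

theorem theorem7:
  fixes \<rho> \<beta> :: real
  assumes "\<rho> > 0" and "\<beta> > 0"
  shows "\<exists>r::real.
    radius_of_convexity (wright_h \<rho> \<beta>) = ereal r \<and>
    smallest_positive_root (deriv (\<lambda>z. z * deriv (wright_h \<rho> \<beta>) z)) r \<and>
    Gamma (\<rho> + \<beta>) / (4 * Gamma \<beta>) < r \<and>
    r < 4 * Gamma (\<rho> + \<beta>) * Gamma (2 * \<rho> + \<beta>) / wright_Delta 16 9 \<rho> \<beta> \<and>
    sqrt ((Gamma (\<rho> + \<beta>))\<^sup>2 * Gamma (2 * \<rho> + \<beta>) / (Gamma \<beta> * wright_Delta 16 9 \<rho> \<beta>)) < r \<and>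
    r < Gamma (\<rho> + \<beta>) * Gamma (3 * \<rho> + \<beta>) * wright_Delta 16 9 \<rho> \<beta> /
        (8 * (Gamma (\<rho> + \<beta>)) ^ 3 * Gamma (2 * \<rho> + \<beta>) +
         2 * Gamma \<beta> * Gamma (3 * \<rho> + \<beta>) * wright_Delta 32 27 \<rho> \<beta>)"
proof -
  interpret wright \<rho> \<beta> using assms by unfold_locales
  obtain r where r: "r > 0" "F 2 (of_real r) = 0"
    "\<And>t. 0 < t \<Longrightarrow> t < r \<Longrightarrow> F 2 (of_real t) \<noteq> 0" using g.smallest_root_exists by metis
  have bounds: "1 < g.s1 * r" "1 < g.s2 * r\<^sup>2" "r * g.s2 < g.s1" "r * g.s3 < g.s2"
    using g.euler_rayleigh_bounds[OF r] by blast+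
  define G where "G = Gamma \<beta>"
  define G1 where "G1 = Gamma (\<rho> + \<beta>)"
  define G2 where "G2 = Gamma (2 * \<rho> + \<beta>)"
  define G3 where "G3 = Gamma (3 * \<rho> + \<beta>)"
  have G: "G > 0" "G1 > 0" "G2 > 0" "G3 > 0"
    using Gamma_pos(2) Gamma_pos(1)[of 1] Gamma_pos(1)[of 2] Gamma_pos(1)[of 3]
    by (simp_all add: G_def G1_def G2_def G3_def)
  \<comment> \<open>\<open>D\<close> is \<open>wright_Delta 16 9\<close> and \<open>E\<close> the
    denominator of the last bound; up to positive Gamma factors they are the numerators of
    \<open>s2\<close> and \<open>s3\<close>.\<close>
  define D where "D = 16 * G * G2 - 9 * G1\<^sup>2"
  define E where "E = 8 * G1 ^ 3 * G2 + 2 * G * G3 * (32 * G * G2 - 27 * G1\<^sup>2)"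
  have U: "U 2 1 = 4 * G / G1" "U 2 2 = 9 * G / (2 * G2)" "U 2 3 = 8 * G / (3 * G3)"
    by (simp_all add: U_def G_def G1_def G2_def G3_def fact_numeral)
  have s1: "g.s1 = 4 * G / G1" by (simp only: g.s1_def U)
  have s2: "g.s2 = G * D / (G1\<^sup>2 * G2)"
    using G by (simp add: g.s2_def U[unfolded One_nat_def] D_def field_simps power2_eq_square)
  have s3: "g.s3 = G * E / (G1 ^ 3 * G2 * G3)"
    using G by (simp add: g.s3_def U[unfolded One_nat_def] E_def field_simps power2_eq_square power3_eq_cube)
  \<comment> \<open>Clearing denominators requires the signs of \<open>D\<close> and
    \<open>E\<close>; they are inherited from \<open>s2 > 0\<close> and
    \<open>s3 \<ge> 1 / r^3\<close>.\<close>
  have "D = g.s2 * (G1\<^sup>2 * G2) / G" using G by (simp add: s2)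
  hence D: "D > 0" using g.s2_pos G by simp
  have "(1 / r) ^ 3 \<le> g.s3" using g.psum_lower[OF r g.psum_lim(3)] .
  moreover have "(1 / r) ^ 3 > 0" using r(1) by simp
  ultimately have "g.s3 > 0" by linarith
  moreover have "E = g.s3 * (G1 ^ 3 * G2 * G3) / G" using G by (simp add: s3)
  ultimately have E: "E > 0" using G by simp
  show ?thesis
    unfolding wright_Delta_def G_def[symmetric] G1_def[symmetric] G2_def[symmetric] G3_def[symmetric]
      D_def[symmetric] E_def[symmetric] deriv_wright_h deriv_g
  proof (intro exI[of _ r] conjI)
    show "radius_of_convexity (wright_h \<rho> \<beta>) = ereal r" by (rule radius_of_convexity_eq[OF r])
    show "smallest_positive_root (F 2) r" unfolding smallest_positive_root_def using r not_le by blast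
    \<comment> \<open>The four bounds come, in this order, from \<open>1 < s1 * r\<close>,
      \<open>r * s2 < s1\<close>, \<open>1 < s2 * r\<^sup>2\<close> and
      \<open>r * s3 < s2\<close>.\<close>
    show "G1 / (4 * G) < r" using bounds(1) G by (simp add: s1 field_simps)
    show "r < 4 * G1 * G2 / D"
      using bounds(3) G D by (simp add: s1 s2 field_simps power2_eq_square)
    have "G1\<^sup>2 * G2 / (G * D) < r\<^sup>2" using bounds(2) G D by (simp add: s2 field_simps)
    thus "sqrt (G1\<^sup>2 * G2 / (G * D)) < r" using r(1) by (simp add: real_less_lsqrt)
    show "r < G1 * G3 * D / E"
      using bounds(4) G E by (simp add: s2 s3 field_simps power2_eq_square power3_eq_cube)
  qed
qed

end
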